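(* Any $\Phi\in\mathfrak{S}_N$ is conjugated to another analytic IFS which has at least one similarity map (i.e. at least one of whose maps is of the form $x\mapsto\lambda x+t$ with $\lambda\in(-1,1)\setminus\{0\}$, $t\in\mathbb{R}$). Moreover, assuming that the attractor of $\Phi$ is not a singleton: (a) $\Phi$ is conjugated to a self-similar IFS if and only if for every $\mathbf{i},\mathbf{j}\in\Sigma$, $H_{\mathbf{i}}(x)=H_{\mathbf{j}}(x)$ for all $x\in[0,1]$; (b) $\Phi$ is sub-conjugated to a self-similar IFS if and only if there exist distinct $\mathbf{i},\mathbf{j}\in\Sigma_*$ of the same length such that $H_{(\mathbf{i})^\infty}(x)=H_{(\mathbf{j})^\infty}(x)$ for all $x\in[0,1]$.
   Context: Fix $\epsilon>0$, write $I=[0,1]$ and, for $\delta>0$, $\mathcal{B}_\delta=\{z\in\mathbb{C}: \exists x\in I,\ |z-x|<\delta\}$. $\mathcal{S}^\omega_\epsilon(I)$ is the class of maps $f:\mathbb{R}\to\mathbb{R}$ such that: (A) $f$ is (extends to be) complex analytic on $\mathcal{B}_{2\epsilon}$; (B) $f(I)\subseteq I$ and $f(\overline{\mathcal{B}_\epsilon})\subseteq\mathcal{B}_\epsilon$; (C) $0<|f'(x)|<1$ for all $x\in\overline{\mathcal{B}_\epsilon}$. $\mathfrak{S}_N$ is the set of ordered $N$-tuples (IFSs) $\Phi=(f_i)_{i=1}^N$ with $f_i\in\mathcal{S}^\omega_\epsilon(I)$. The attractor of $\Phi$ is the unique non-empty compact $\Lambda\subseteq[0,1]$ with $\Lambda=\bigcup_i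 f_i(\Lambda)$. Let $\mathcal{I}=\{1,\dots,N\}$, $\Sigma_n=\mathcal{I}^n$, $\Sigma_*=\bigcup_{n\ge0}\Sigma_n$, $\Sigma=\mathcal{I}^{\mathbb{N}}$; $|\mathbf{i}|$ is the length of a word; $(\mathbf{i})^\infty\in\Sigma$ is the infinite concatenation of $\mathbf{i}\in\Sigma_*$ with itself. For a finite word, $f_{\mathbf{i}}=f_{i_1}\circ\cdots\circ f_{i_n}$, $f_\emptyset=\mathrm{Id}$; and $\mathbf{i}_{n}^1=(i_n,\dots,i_1)$, so $f_{\mathbf{i}_n^1}=f_{i_n}\circ\cdots\circ f_{i_1}$, with $\mathbf{i}_0^1=\emptyset$. For $\mathbf{i}\in\Sigma$, $$H_{\mathbf{i}}(x)=\sum_{n=1}^{\infty}\frac{f''_{i_n}}{f'_{i_n}}\big(f_{\mathbf{i}_{n-1}^1}(x)\big)\cdot f'_{\mathbf{i}_{n-1}^1}(x).$$ An IFS $(f_i)_i$ of analytic maps of $[0,1]$ is conjugated to another IFS $\Psi$ if there is an analytic, invertible (onto its image) $g:[0,1]\to\mathbb{R}$ such that $\Psi=(g\circ f_i\circ g^{-1})_i$ (a tuple of self-maps of the interval $g([0,1])$); "analytic IFS" here means that the maps $g\circ f_i\circ g^{-1}$ are analytic. In particular it is conjugated to a self-similar IFS if there are such $g$ and $\lambda_i\in(-1,1)\setminus\{0\}$, $t_i\in\mathbb{R}$ with $f_i(x)=g^{-1}(\lambda_i g(x)+t_i)$ for all $i$ and $x\in[0,1]$. $\Phi$ is sub-conjugated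 to a self-similar IFS if there are distinct $\mathbf{i},\mathbf{j}\in\Sigma_*$ of the same length such that the IFS $(f_{\mathbf{i}},f_{\mathbf{j}})$ is conjugated to a self-similar IFS. *)

theory Defs
  imports "HOL-Complex_Analysis.Complex_Analysis"
begin

definition nbhd :: "real \<Rightarrow> complex set" where
  "nbhd \<delta> = {z. \<exists>x\<in>{0..1::real}. cmod (z - complex_of_real x) < \<delta>}"

text \<open>
  The complex analytic extension \<open>F\<close> is unique on \<open>nbhd (2 * \<epsilon>)\<close> by the identity theorem,
  so it does not matter that it is existentially quantified. The values of \<open>f\<close> at reals
  outside \<open>nbhd (2 * \<epsilon>)\<close> are unconstrained.
\<close>
definition analytic_contractions :: "real \<Rightarrow> (real \<Rightarrow> real) set" where
  "analytic_contractions \<epsilon> = {f. \<exists>F.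
      F analytic_on nbhd (2 * \<epsilon>) \<and>
      (\<forall>x. complex_of_real x \<in> nbhd (2 * \<epsilon>) \<longrightarrow> F (complex_of_real x) = complex_of_real (f x)) \<and>
      f ` {0..1} \<subseteq> {0..1} \<and>
      F ` closure (nbhd \<epsilon>) \<subseteq> nbhd \<epsilon> \<and>
      (\<forall>z\<in>closure (nbhd \<epsilon>). 0 < cmod (deriv F z) \<and> cmod (deriv F z) < 1)}"

definition IFS :: "real \<Rightarrow> nat \<Rightarrow> (real \<Rightarrow> real) list set" where
  "IFS \<epsilon> N = {\<Phi>. length \<Phi> = N \<and> set \<Phi> \<subseteq> analytic_contractions \<epsilon>}"

definition attractor :: "(real \<Rightarrow> real) list \<Rightarrow> real set" where
  "attractor \<Phi> = (THE \<Lambda>. \<Lambda> \<noteq> {} \<and> compact \<Lambda> \<and> \<Lambda> \<subseteq> {0..1} \<and> \<Lambda> = (\<Union>f\<in>set \<Phi>. f ` \<Lambda>))"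

text \<open>The alphabet is \<open>{0..<N}\<close>, and the first letter of an infinite word has index \<open>0\<close>.\<close>

definition words :: "nat \<Rightarrow> nat list set" where
  "words N = {w. set w \<subseteq> {0..<N}}"

definition infwords :: "nat \<Rightarrow> (nat \<Rightarrow> nat) set" where
  "infwords N = {i. range i \<subseteq> {0..<N}}"

definition periodic :: "nat list \<Rightarrow> nat \<Rightarrow> nat" where
  "periodic w n = w ! (n mod length w)"

definition word_map :: "(real \<Rightarrow> real) list \<Rightarrow> nat list \<Rightarrow> real \<Rightarrow> real" where
  "word_map \<Phi> w = foldr (\<lambda>k h. (\<Phi> ! k) \<circ> h) w id"

definition rev_prefix :: "(nat \<Rightarrow> nat) \<Rightarrow> nat \<Rightarrow> nat list" where
  "rev_prefix i n = rev (map i [0..<n])"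

definition H :: "(real \<Rightarrow> real) list \<Rightarrow> (nat \<Rightarrow> nat) \<Rightarrow> real \<Rightarrow> real" where
  "H \<Phi> i x = (\<Sum>n. deriv (deriv (\<Phi> ! i n)) (word_map \<Phi> (rev_prefix i n) x)
                   / deriv (\<Phi> ! i n) (word_map \<Phi> (rev_prefix i n) x)
                 * deriv (word_map \<Phi> (rev_prefix i n)) x)"

text \<open>
  For an interval with more than one point this is real analyticity (up to and including
  the end points): the function extends complex analytically to a neighbourhood in \<open>\<complex>\<close>.
\<close>
definition real_analytic_on :: "(real \<Rightarrow> real) \<Rightarrow> real set \<Rightarrow> bool" where
  "real_analytic_on g S \<longleftrightarrow>
     (\<exists>G. G analytic_on (complex_of_real ` S) \<and>
          (\<forall>x\<in>S. G (complex_of_real x) = complex_of_real (g x)))"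

text \<open>The maps of \<open>\<Psi>\<close> matter only on the interval \<open>g ` {0..1}\<close>.\<close>
definition conjugated_via ::
    "(real \<Rightarrow> real) \<Rightarrow> (real \<Rightarrow> real) list \<Rightarrow> (real \<Rightarrow> real) list \<Rightarrow> bool" where
  "conjugated_via g \<Phi> \<Psi> \<longleftrightarrow>
     real_analytic_on g {0..1} \<and> inj_on g {0..1} \<and>
     list_all2 (\<lambda>f h. \<forall>y\<in>g ` {0..1}. h y = g (f (the_inv_into {0..1} g y))) \<Phi> \<Psi>"

definition analytic_IFS_on :: "real set \<Rightarrow> (real \<Rightarrow> real) list \<Rightarrow> bool" where
  "analytic_IFS_on J \<Psi> \<longleftrightarrow> (\<forall>h\<in>set \<Psi>. real_analytic_on h J)"

definition similarity_on :: "real set \<Rightarrow> (real \<Rightarrow> real) \<Rightarrow> bool" where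
  "similarity_on J h \<longleftrightarrow> (\<exists>c t. c \<in> {-1<..<1} - {0} \<and> (\<forall>y\<in>J. h y = c * y + t))"

definition conjugated_to_self_similar :: "(real \<Rightarrow> real) list \<Rightarrow> bool" where
  "conjugated_to_self_similar \<Phi> \<longleftrightarrow>
     (\<exists>g \<Psi>. conjugated_via g \<Phi> \<Psi> \<and> (\<forall>h\<in>set \<Psi>. similarity_on (g ` {0..1}) h))"

definition sub_conjugated_to_self_similar :: "(real \<Rightarrow> real) list \<Rightarrow> bool" where
  "sub_conjugated_to_self_similar \<Phi> \<longleftrightarrow>
     (\<exists>i\<in>words (length \<Phi>). \<exists>j\<in>words (length \<Phi>). i \<noteq> j \<and> length i = length j \<and>
        conjugated_to_self_similar [word_map \<Phi> i, word_map \<Phi> j])"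

text \<open>
  The explicit form \<open>f x = g\<inverse> (c * g x + t)\<close>; the membership condition is what makes
  \<open>g\<inverse>\<close> meaningful there.
\<close>
lemma conjugated_to_self_similar_iff:
  assumes "\<forall>f\<in>set \<Phi>. f ` {0..1} \<subseteq> {0..1}"
  shows "conjugated_to_self_similar \<Phi> \<longleftrightarrow>
     (\<exists>g. real_analytic_on g {0..1} \<and> inj_on g {0..1} \<and>
        (\<forall>f\<in>set \<Phi>. \<exists>c t. c \<in> {-1<..<1} - {0} \<and>
           (\<forall>x\<in>{0..1}. c * g x + t \<in> g ` {0..1} \<and>
              f x = the_inv_into {0..1} g (c * g x + t))))"
    (is "_ \<longleftrightarrow> (\<exists>g. ?R g)")
proof -
  have key: "(\<exists>\<Psi>. conjugated_via g \<Phi> \<Psi> \<and> (\<forall>h\<in>set \<Psi>. similarity_on (g ` {0..1}) h)) \<longleftrightarrow> ?R g" for g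
  proof (cases "inj_on g {0..1}")
    case inj: True
    have eq: "(\<forall>x\<in>{0..1}. g (f x) = c * g x + t) \<longleftrightarrow>
        (\<forall>x\<in>{0..1}. c * g x + t \<in> g ` {0..1} \<and> f x = the_inv_into {0..1} g (c * g x + t))"
      if "f \<in> set \<Phi>" for f c t
    proof (intro ball_cong refl iffI conjI)
      fix x :: real assume x: "x \<in> {0..1}"
      have fx: "f x \<in> {0..1}" using assms that x by blast
      { assume e: "g (f x) = c * g x + t"
        show "c * g x + t \<in> g ` {0..1}" using fx e by (metis imageI)
        show "f x = the_inv_into {0..1} g (c * g x + t)"
          using the_inv_into_f_f[OF inj fx] e by simp }
      { assume "c * g x + t \<in> g ` {0..1} \<and> f x = the_inv_into {0..1} g (c * g x + t)"
        then show "g (f x) = c * g x + t" using f_the_inv_into_f[OF inj] by metis }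
    qed
    have sim: "similarity_on (g ` {0..1}) h \<longleftrightarrow>
        (\<exists>c t. c \<in> {-1<..<1} - {0} \<and> (\<forall>x\<in>{0..1}. g (f x) = c * g x + t))"
      if "\<forall>y\<in>g ` {0..1}. h y = g (f (the_inv_into {0..1} g y))" for f h
      using that by (simp add: similarity_on_def the_inv_into_f_f[OF inj])
    have "(\<exists>\<Psi>. conjugated_via g \<Phi> \<Psi> \<and> (\<forall>h\<in>set \<Psi>. similarity_on (g ` {0..1}) h)) \<longleftrightarrow>
       real_analytic_on g {0..1} \<and>
       (\<forall>f\<in>set \<Phi>. \<exists>c t. c \<in> {-1<..<1} - {0} \<and> (\<forall>x\<in>{0..1}. g (f x) = c * g x + t))"
      (is "?A \<longleftrightarrow> ?B")
    proof
      assume ?A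
      then obtain \<Psi> where \<Psi>: "conjugated_via g \<Phi> \<Psi>"
        "\<forall>h\<in>set \<Psi>. similarity_on (g ` {0..1}) h" by blast
      show ?B
      proof (intro conjI ballI)
        show "real_analytic_on g {0..1}" using \<Psi> by (simp add: conjugated_via_def)
        fix f assume "f \<in> set \<Phi>"
        then obtain h where h: "h \<in> set \<Psi>"
          "\<forall>y\<in>g ` {0..1}. h y = g (f (the_inv_into {0..1} g y))"
          using \<Psi>(1) unfolding conjugated_via_def list_all2_conv_all_nth in_set_conv_nth by metis
        show "\<exists>c t. c \<in> {-1<..<1} - {0} \<and> (\<forall>x\<in>{0..1}. g (f x) = c * g x + t)"
          using sim[OF h(2)] \<Psi>(2) h(1) by blast
      qed
    next
      assume B: ?B
      let ?\<Psi> = "map (\<lambda>f y. g (f (the_inv_into {0..1} g y))) \<Phi>"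
      have "conjugated_via g \<Phi> ?\<Psi>"
        using B inj by (simp add: conjugated_via_def list_all2_conv_all_nth)
      moreover have "\<forall>h\<in>set ?\<Psi>. similarity_on (g ` {0..1}) h"
      proof
        fix h assume "h \<in> set ?\<Psi>"
        then obtain f where f: "f \<in> set \<Phi>"
          "\<forall>y\<in>g ` {0..1}. h y = g (f (the_inv_into {0..1} g y))" by auto
        show "similarity_on (g ` {0..1}) h"
          unfolding sim[OF f(2)] using B f(1) by blast
      qed
      ultimately show ?A by blast
    qed
    then show ?thesis using inj eq by simp
  qed (simp add: conjugated_via_def)
  show ?thesis unfolding conjugated_to_self_similar_def by (simp only: key)
qed

end

theory Submission
  imports Defs
begin

text \<open>
  Extend the maps to a complex neighbourhood \<open>U\<close> of \<open>[0,1]\<close>. If \<open>G \<circ> F = l * G + t\<close>, then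
  \<open>h = G'' / G'\<close> solves \<open>h = F'' / F' + (h \<circ> F) * F'\<close>; conversely, a holomorphic solution \<open>h\<close>
  yields such a \<open>G\<close> by integrating \<open>G' = exp (\<integral> h)\<close>, and the same \<open>G\<close> serves all \<open>F\<close> whose equation
  \<open>h\<close> solves. Because \<open>F'\<close> is bounded by a constant smaller than \<open>1\<close>, the equation has at most one
  bounded solution. The series \<open>H\<^sub>i\<close> converges uniformly on \<open>U\<close>, and for a periodic
  \<open>i = w w w \<dots>\<close> it solves the equation of the composition along the reversed word \<open>w\<close>.

  The conjugacy \<open>g\<close> in the definition of self-similarity is only required to be injective, so \<open>g'\<close>
  may vanish. Then its only zero \<open>p\<close> is a fixed point of all maps involved, \<open>g - g p\<close> is a constant
  times the \<open>n\<close>-th power of the linearising coordinate at \<open>p\<close>, and the equation is solved by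
  \<open>v' / (n v)\<close> with \<open>v = g' ^ n / (g - g p) ^ (n - 1)\<close> in place of \<open>g'' / g'\<close>.
\<close>

section \<open>Analytic functions along the unit interval\<close>

definition unit_seg :: "complex set" where
  "unit_seg = complex_of_real ` {0..1}"

definition pre_schwarzian :: "(complex \<Rightarrow> complex) \<Rightarrow> complex \<Rightarrow> complex" where
  "pre_schwarzian F z = deriv (deriv F) z / deriv F z"

text \<open>The functional equation satisfied by \<open>G'' / G'\<close> when \<open>G \<circ> F = l * G + t\<close>.\<close>
definition log_cocycle :: "(complex \<Rightarrow> complex) \<Rightarrow> (complex \<Rightarrow> complex) \<Rightarrow> bool" where
  "log_cocycle F q \<longleftrightarrow> (\<forall>z\<in>unit_seg. q z = pre_schwarzian F z + q (F z) * deriv F z)"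

text \<open>The rate \<open>c\<close> is a parameter so that all maps of a family can share it. The
  condition concerns the segment alone, where fixed points lie and orbits are followed.\<close>

definition seg_contraction :: "real \<Rightarrow> (complex \<Rightarrow> complex) \<Rightarrow> bool" where
  "seg_contraction c F \<longleftrightarrow> F analytic_on unit_seg \<and> F ` unit_seg \<subseteq> unit_seg \<and>
     (\<forall>z\<in>unit_seg. deriv F z \<noteq> 0 \<and> cmod (deriv F z) \<le> c) \<and> c < 1"

lemma unit_seg_eq: "unit_seg = closed_segment 0 1"
  using closed_segment_of_real[of 0 1, where 'a=complex]
  by (simp add: unit_seg_def closed_segment_eq_real_ivl)

lemma convex_unit_seg: "convex unit_seg"
  and compact_unit_seg: "compact unit_seg"
  by (simp_all add: unit_seg_eq)

text \<open>A connected set with two points has no isolated point. Hence derivatives within the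
  segment are unique, and an identity known off one point extends to that point by
  continuity.\<close>

lemma islimpt_unit_seg:
  assumes "z \<in> unit_seg" shows "z islimpt unit_seg"
proof -
  have "0 \<in> unit_seg" "1 \<in> unit_seg" "connected unit_seg"
    by (simp_all add: unit_seg_eq)
  then show ?thesis
    using assms by (metis connected_imp_perfect singletonD zero_neq_one)
qed

section \<open>Complex neighbourhoods of the segment\<close>

lemma nbhd_eq: "nbhd d = (\<Union>z\<in>unit_seg. ball z d)"
  by (auto simp: nbhd_def unit_seg_def dist_norm norm_minus_commute)

lemma open_nbhd: "open (nbhd d)"
  by (auto simp: nbhd_eq)

text \<open>The neighbourhood is the Minkowski sum of the segment and a disc. Convexity later
  supplies primitives and the injectivity criterion.\<close>

lemma convex_nbhd: "convex (nbhd d)"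
proof -
  have "nbhd d = (\<Union>x\<in>unit_seg. \<Union>y\<in>ball 0 d. {x + y})"
  proof (intro set_eqI iffI)
    fix z assume "z \<in> nbhd d"
    then obtain w where "w \<in> unit_seg" "dist w z < d"
      by (auto simp: nbhd_eq)
    then have "z = w + (z - w) \<and> w \<in> unit_seg \<and> z - w \<in> ball 0 d"
      by (simp add: dist_norm norm_minus_commute)
    then show "z \<in> (\<Union>x\<in>unit_seg. \<Union>y\<in>ball 0 d. {x + y})"
      by blast
  next
    fix z assume "z \<in> (\<Union>x\<in>unit_seg. \<Union>y\<in>ball 0 d. {x + y})"
    then show "z \<in> nbhd d"
      by (force simp: nbhd_eq dist_norm)
  qed
  then show ?thesis
    using convex_sums[OF convex_unit_seg convex_ball[of 0 d]] by simp
qed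

lemma unit_seg_subset_nbhd: "d > 0 \<Longrightarrow> unit_seg \<subseteq> nbhd d"
  by (force simp: nbhd_eq)

lemma closure_nbhd_subset:
  assumes "d > 0" shows "closure (nbhd d) \<subseteq> nbhd (2 * d)"
proof
  fix z assume "z \<in> closure (nbhd d)"
  then obtain w where "w \<in> nbhd d" "dist w z < d"
    using assms by (meson closure_approachable)
  then obtain x where x: "x \<in> unit_seg" "dist x w < d"
    by (auto simp: nbhd_eq)
  have "dist x z < 2 * d"
    using dist_triangle[of x z w] x \<open>dist w z < d\<close> by linarith
  then show "z \<in> nbhd (2 * d)"
    using x by (auto simp: nbhd_eq)
qed

lemma compact_closure_nbhd: "compact (closure (nbhd d))"
proof -
  have "nbhd d \<subseteq> ball 0 (1 + d)"
  proof
    fix z assume "z \<in> nbhd d"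
    then obtain x where x: "x \<in> {0..1}" "cmod (z - complex_of_real x) < d"
      by (auto simp: nbhd_def)
    have "cmod z \<le> cmod (z - of_real x) + cmod (of_real x)"
      by (metis diff_add_cancel norm_triangle_ineq)
    then show "z \<in> ball 0 (1 + d)"
      using x by auto
  qed
  then have "bounded (nbhd d)"
    using bounded_ball bounded_subset by blast
  then show ?thesis
    by (simp add: compact_closure)
qed

section \<open>Derivatives along the segment\<close>

lemma analytic_on_unit_seg:
  assumes "F holomorphic_on nbhd d" "d > 0" shows "F analytic_on unit_seg"
  using assms open_nbhd unit_seg_subset_nbhd analytic_on_holomorphic by blast

lemma analytic_on_point: "F analytic_on S \<Longrightarrow> z \<in> S \<Longrightarrow> F analytic_on {z}"
  by (meson analytic_on_analytic_at)

lemma deriv_zero_imp_const_on_unit_seg: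
  assumes "P analytic_on unit_seg" "\<And>z. z \<in> unit_seg \<Longrightarrow> deriv P z = 0"
  obtains a where "\<And>z. z \<in> unit_seg \<Longrightarrow> P z = a"
proof -
  have "(P has_field_derivative 0) (at z within unit_seg)" if "z \<in> unit_seg" for z
    using analytic_derivI[OF analytic_on_point[OF assms(1) that]] assms(2)[OF that] by metis
  then show ?thesis
    using has_field_derivative_zero_constant[OF convex_unit_seg] that by blast
qed

text \<open>Analyticity provides a full complex derivative, which is also a derivative within the
  segment; the two limits agree because no point of the segment is isolated.\<close>

lemma deriv_unique_on_unit_seg:
  assumes "P analytic_on {z}" "z \<in> unit_seg"
    and "(P has_field_derivative D) (at z within unit_seg)"
  shows "deriv P z = D"
proof -
  have "(P has_field_derivative deriv P z) (at z within unit_seg)"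
    by (rule analytic_derivI[OF assms(1)])
  with assms(3) show ?thesis
    using islimpt_unit_seg[OF assms(2)] unfolding has_field_derivative_iff
    by (metis tendsto_unique trivial_limit_within)
qed

text \<open>The device by which identities known only on the segment are differentiated: the
  derivative within the segment is 0, and the complex derivative equals it.\<close>

lemma const_on_unit_seg_imp_deriv_zero:
  assumes "P analytic_on unit_seg" "\<And>z. z \<in> unit_seg \<Longrightarrow> P z = a" "z \<in> unit_seg"
  shows "deriv P z = 0"
proof (rule deriv_unique_on_unit_seg)
  show "P analytic_on {z}"
    using assms analytic_on_point by blast
  show "(P has_field_derivative 0) (at z within unit_seg)"
    by (rule has_field_derivative_transform_within[OF DERIV_const zero_less_one assms(3)])
       (simp add: assms(2))
qed (use assms in auto)

text \<open>The imaginary part along the segment is a real function with zero derivative that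
  vanishes at 0.\<close>

lemma real_deriv_imp_real_on_unit_seg:
  assumes P: "P analytic_on unit_seg" and real: "\<And>z. z \<in> unit_seg \<Longrightarrow> deriv P z \<in> \<real>"
    and "P 0 = 0" "z \<in> unit_seg"
  shows "P z \<in> \<real>"
proof -
  define g where "g x = Im (P (of_real x))" for x
  have "(g has_field_derivative 0) (at x within {0..1})" if x: "x \<in> {0..1}" for x :: real
  proof -
    have "complex_of_real x \<in> unit_seg" using x by (auto simp: unit_seg_def)
    then have "(P has_field_derivative deriv P (of_real x)) (at (of_real x))" "deriv P (of_real x) \<in> \<real>"
      using analytic_derivI[OF analytic_on_point[OF P]] real by blast+
    then have "((\<lambda>x. P (of_real x)) has_vector_derivative deriv P (of_real x)) (at x within {0..1})"
      by (intro has_vector_derivative_real_field)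
    then have "((\<lambda>x. Im (P (of_real x))) has_vector_derivative Im (deriv P (of_real x))) (at x within {0..1})"
      by (rule bounded_linear.has_vector_derivative[OF bounded_linear_Im])
    then show ?thesis
      using \<open>deriv P (of_real x) \<in> \<real>\<close>
      by (simp add: g_def[abs_def] complex_is_Real_iff has_real_derivative_iff_has_vector_derivative)
  qed
  then obtain a where "\<And>x. x \<in> {0..1} \<Longrightarrow> g x = a"
    using has_field_derivative_zero_constant[of "{0..1::real}" g] by auto
  then have "g x = g 0" if "x \<in> {0..1}" for x
    using that by (metis atLeastAtMost_iff order.refl zero_le_one)
  then show ?thesis
    using assms(3,4) by (auto simp: unit_seg_def g_def complex_is_Real_iff)
qed

lemma contraction_on_unit_seg:
  assumes "F analytic_on unit_seg" "\<And>z. z \<in> unit_seg \<Longrightarrow> cmod (deriv F z) \<le> c"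
    and "x \<in> unit_seg" "y \<in> unit_seg"
  shows "dist (F x) (F y) \<le> c * dist x y"
  unfolding dist_norm
  by (rule field_differentiable_bound[OF convex_unit_seg analytic_derivI[OF analytic_on_point[OF assms(1)]] assms(2-4)])

lemma fixed_point_on_unit_seg:
  assumes "F analytic_on unit_seg" "\<And>z. z \<in> unit_seg \<Longrightarrow> cmod (deriv F z) \<le> c"
    and "F ` unit_seg \<subseteq> unit_seg" "c < 1"
  shows "\<exists>!p\<in>unit_seg. F p = p"
proof (rule Banach_fix)
  show "complete unit_seg" "unit_seg \<noteq> {}"
    using compact_unit_seg by (auto simp: compact_imp_complete unit_seg_def)
  have "0 \<in> unit_seg"
    by (simp add: unit_seg_eq)
  from assms(2)[OF this] show "0 \<le> c"
    using norm_ge_zero order_trans by blast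
  show "dist (F x) (F y) \<le> c * dist x y" if "x \<in> unit_seg" "y \<in> unit_seg" for x y
    using assms(1,2) that by (rule contraction_on_unit_seg)
qed (use assms in auto)

text \<open>Differentiate along the real axis and separate real and imaginary parts; the imaginary
  part of \<open>F\<close> is 0 there. Since the conclusion holds at every real point of
  \<open>U\<close>, the lemma applies again to \<open>deriv F\<close> and yields second
  derivatives.\<close>

lemma deriv_commute_of_real:
  assumes "F holomorphic_on U" "open U"
    and eq: "\<And>x. of_real x \<in> U \<Longrightarrow> F (of_real x) = complex_of_real (f x)"
    and x: "complex_of_real x \<in> U"
  shows "deriv F (of_real x) = of_real (deriv f x)"
proof -
  let ?D = "deriv F (of_real x)"
  have "(F has_field_derivative ?D) (at (of_real x))"
    using holomorphic_derivI assms by blast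
  then have D: "((\<lambda>y. F (of_real y)) has_vector_derivative ?D) (at x)"
    by (rule has_vector_derivative_real_field)
  have "open (complex_of_real -` U)"
    using assms(2) by (simp add: open_vimage)
  then have "((\<lambda>y. complex_of_real (f y)) has_vector_derivative ?D) (at x)"
    by (rule has_vector_derivative_transform_within_open[OF D]) (use x eq in auto)
  note Re = bounded_linear.has_vector_derivative[OF bounded_linear_Re this]
    and Im = bounded_linear.has_vector_derivative[OF bounded_linear_Im this]
  have "(f has_real_derivative Re ?D) (at x)"
    using Re by (simp add: has_real_derivative_iff_has_vector_derivative)
  moreover have "((\<lambda>_. 0) has_real_derivative Im ?D) (at x)"
    using Im by (simp add: has_real_derivative_iff_has_vector_derivative)
  then have "Im ?D = 0"
    by (metis DERIV_const DERIV_unique)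
  ultimately show ?thesis
    by (simp add: complex_eq_iff DERIV_imp_deriv)
qed

section \<open>Linearising coordinates from solutions of the functional equation\<close>

text \<open>The Noshiro-Warschawski argument: if \<open>G z = G w\<close>, a strictly increasing
  function along the segment from \<open>z\<close> to \<open>w\<close> would take equal values at
  both ends.\<close>

lemma inj_on_if_Re_deriv_pos:
  assumes "G holomorphic_on S" "open S" "convex S"
    and pos: "\<And>z. z \<in> S \<Longrightarrow> Re (deriv G z) > 0"
  shows "inj_on G S"
proof (rule inj_onI, rule ccontr)
  fix z w assume zw: "z \<in> S" "w \<in> S" "G z = G w" "z \<noteq> w"
  define \<gamma> where "\<gamma> t = z + of_real t * (w - z)" for t :: real
  have \<gamma>: "\<gamma> t \<in> S" if "0 \<le> t" "t \<le> 1" for t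
  proof -
    have "\<gamma> t = (1 - t) *\<^sub>R z + t *\<^sub>R w"
      by (simp add: \<gamma>_def scaleR_conv_of_real algebra_simps)
    then show ?thesis
      using convexD_alt[OF assms(3) zw(1,2) that] by simp
  qed
  \<comment> \<open>Dividing by \<open>w - z\<close> cancels the velocity of
    \<open>\<gamma>\<close>, so the derivative of \<open>\<phi>\<close> is the real part of
    \<open>deriv G\<close> along the path.\<close>
  define \<phi> where "\<phi> t = Re (G (\<gamma> t) / (w - z))" for t
  have "\<phi> 0 < \<phi> 1"
  proof (rule DERIV_pos_imp_increasing[where f = \<phi>])
    fix t :: real assume t: "0 \<le> t" "t \<le> 1"
    have "((\<lambda>s. G (z + s * (w - z)) / (w - z)) has_field_derivative
            deriv G (\<gamma> t) * (w - z) / (w - z)) (at (of_real t))"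
      unfolding \<gamma>_def
      by (rule derivative_eq_intros DERIV_chain2[OF holomorphic_derivI[OF assms(1,2)]] refl
            \<gamma>[OF t, unfolded \<gamma>_def])+ (use zw in simp_all)
    then have "((\<lambda>s. G (\<gamma> s) / (w - z)) has_vector_derivative deriv G (\<gamma> t)) (at t)"
      using zw by (subst \<gamma>_def, intro has_vector_derivative_real_field) auto
    then have "(\<phi> has_real_derivative Re (deriv G (\<gamma> t))) (at t)"
      unfolding \<phi>_def has_real_derivative_iff_has_vector_derivative
      by (rule bounded_linear.has_vector_derivative[OF bounded_linear_Re])
    then show "\<exists>y. DERIV \<phi> t :> y \<and> y > 0"
      using pos[OF \<gamma>[OF t]] by blast
  qed simp
  then show False
    using zw by (simp add: \<phi>_def \<gamma>_def)
qed

lemma real_primitive_on_nbhd: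
  assumes "h holomorphic_on nbhd \<epsilon>" "\<epsilon> > 0" "\<And>z. z \<in> unit_seg \<Longrightarrow> h z \<in> \<real>"
  obtains A where "\<And>z. z \<in> nbhd \<epsilon> \<Longrightarrow> (A has_field_derivative h z) (at z)"
    "\<And>z. z \<in> unit_seg \<Longrightarrow> A z \<in> \<real>"
proof -
  obtain B where B: "\<And>z. z \<in> nbhd \<epsilon> \<Longrightarrow> (B has_field_derivative h z) (at z within nbhd \<epsilon>)"
    using holomorphic_convex_primitive'[OF convex_nbhd open_nbhd assms(1)] by blast
  \<comment> \<open>The primitive is normalised to vanish at 0, from where reality propagates along
    the segment.\<close>
  define A where "A z = B z - B 0" for z
  have A: "(A has_field_derivative h z) (at z)" if "z \<in> nbhd \<epsilon>" for z
    using B[OF that] that unfolding A_def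
    by (auto intro!: derivative_eq_intros simp: at_within_open[OF _ open_nbhd])
  then have "A holomorphic_on nbhd \<epsilon>"
    using open_nbhd holomorphic_on_open by blast
  then have "A analytic_on unit_seg"
    using analytic_on_unit_seg assms(2) by blast
  moreover have "deriv A z \<in> \<real>" if "z \<in> unit_seg" for z
    using A[of z] that assms(2,3) unit_seg_subset_nbhd by (metis DERIV_imp_deriv subsetD)
  ultimately have "A z \<in> \<real>" if "z \<in> unit_seg" for z
    using that real_deriv_imp_real_on_unit_seg[of A] by (simp add: A_def)
  then show thesis
    using that A by blast
qed

text \<open>The differential equation is \<open>G'' / G' = h\<close> without division. Real values
  make \<open>G\<close> restrict to a real coordinate on [0,1], and the positive derivative makes
  that coordinate injective.\<close>

definition linearizer :: "real \<Rightarrow> (complex \<Rightarrow> complex) \<Rightarrow> (complex \<Rightarrow> complex) \<Rightarrow> bool" where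
  "linearizer \<epsilon> h G \<longleftrightarrow> G holomorphic_on nbhd \<epsilon> \<and> G ` unit_seg \<subseteq> \<real> \<and>
     (\<forall>z\<in>unit_seg. Re (deriv G z) > 0 \<and> deriv (deriv G) z = h z * deriv G z)"

text \<open>Two primitives in succession: \<open>A\<close> of \<open>h\<close>, then
  \<open>G\<close> of \<open>exp A\<close>. Since \<open>A\<close> is real on the segment,
  \<open>exp A\<close> is positive there.\<close>

lemma linearizer_exists:
  assumes "h holomorphic_on nbhd \<epsilon>" "\<epsilon> > 0" "\<And>z. z \<in> unit_seg \<Longrightarrow> h z \<in> \<real>"
  obtains G where "linearizer \<epsilon> h G"
proof -
  obtain A where A: "\<And>z. z \<in> nbhd \<epsilon> \<Longrightarrow> (A has_field_derivative h z) (at z)"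
    "\<And>z. z \<in> unit_seg \<Longrightarrow> A z \<in> \<real>"
    using real_primitive_on_nbhd[OF assms] by blast
  have "A holomorphic_on nbhd \<epsilon>"
    using A(1) open_nbhd holomorphic_on_open by blast
  then have "(\<lambda>z. exp (A z)) holomorphic_on nbhd \<epsilon>"
    by (intro holomorphic_intros)
  then obtain G where G: "\<And>z. z \<in> nbhd \<epsilon> \<Longrightarrow> (G has_field_derivative exp (A z)) (at z)"
    "\<And>z. z \<in> unit_seg \<Longrightarrow> G z \<in> \<real>"
    using real_primitive_on_nbhd[of "\<lambda>z. exp (A z)" \<epsilon>] assms(2) A(2) by auto
  have dG: "deriv G z = exp (A z)" if "z \<in> nbhd \<epsilon>" for z
    using G(1)[OF that] by (rule DERIV_imp_deriv)
  have "deriv (deriv G) z = h z * deriv G z" if "z \<in> nbhd \<epsilon>" for z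
  proof -
    have "((\<lambda>z. exp (A z)) has_field_derivative h z * exp (A z)) (at z)"
      by (auto intro!: derivative_eq_intros A that)
    then have "(deriv G has_field_derivative h z * exp (A z)) (at z)"
      by (rule has_field_derivative_transform_within_open[OF _ open_nbhd that]) (simp add: dG)
    then show ?thesis
      using dG that by (simp add: DERIV_imp_deriv)
  qed
  moreover have "Re (deriv G z) > 0" if "z \<in> unit_seg" for z
  proof -
    have "z \<in> nbhd \<epsilon>" using that assms(2) unit_seg_subset_nbhd by blast
    then show ?thesis
      using A(2)[OF that] by (auto simp: dG complex_is_Real_iff Re_exp)
  qed
  moreover have "G holomorphic_on nbhd \<epsilon>"
    using G(1) open_nbhd holomorphic_on_open by blast
  ultimately show thesis
    using that G(2) assms(2) unit_seg_subset_nbhd unfolding linearizer_def by blast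
qed

text \<open>Positivity of the real part of \<open>deriv G\<close> is an open condition, so by
  compactness it holds on a whole neighbourhood \<open>nbhd \<delta>\<close>, which is
  convex.\<close>

lemma linearizer_inj:
  assumes "linearizer \<epsilon> h G" "\<epsilon> > 0"
  obtains \<delta> where "\<delta> > 0" "nbhd \<delta> \<subseteq> nbhd \<epsilon>" "inj_on G (nbhd \<delta>)"
proof -
  have G: "G holomorphic_on nbhd \<epsilon>"
    using assms by (simp add: linearizer_def)
  define V where "V = nbhd \<epsilon> \<inter> deriv G -` {z. Re z > 0}"
  have "open V"
    unfolding V_def
    by (intro continuous_open_preimage open_nbhd open_halfspace_Re_gt
          holomorphic_on_imp_continuous_on holomorphic_deriv G)
  moreover have "unit_seg \<subseteq> V"
    using assms unit_seg_subset_nbhd by (auto simp: V_def linearizer_def)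
  ultimately obtain \<delta> where \<delta>: "\<delta> > 0" "nbhd \<delta> \<subseteq> V"
    using compact_subset_open_imp_ball_epsilon_subset[OF compact_unit_seg] nbhd_eq by metis
  then have "inj_on G (nbhd \<delta>)"
    by (intro inj_on_if_Re_deriv_pos open_nbhd convex_nbhd holomorphic_on_subset[OF G])
       (auto simp: V_def)
  then show thesis
    using that \<delta> by (auto simp: V_def)
qed

text \<open>The functional equation says that the logarithmic derivatives of
  \<open>(G \<circ> F)'\<close> and \<open>G'\<close> agree. Their quotient \<open>\<psi>\<close> is
  therefore constant, and one integration gives the affine relation.\<close>

lemma linearizer_conjugates:
  assumes "linearizer \<epsilon> h G" "\<epsilon> > 0"
    and "seg_contraction c F" and h: "log_cocycle F h"
  obtains p t where "p \<in> unit_seg" "\<And>z. z \<in> unit_seg \<Longrightarrow> G (F z) = deriv F p * G z + t"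
proof -
  have F: "F analytic_on unit_seg" "F ` unit_seg \<subseteq> unit_seg"
      "\<And>z. z \<in> unit_seg \<Longrightarrow> deriv F z \<noteq> 0" "\<And>z. z \<in> unit_seg \<Longrightarrow> cmod (deriv F z) \<le> c" "c < 1"
    using assms(3) by (auto simp: seg_contraction_def)
  have G: "G analytic_on unit_seg"
    using assms analytic_on_unit_seg by (auto simp: linearizer_def)
  have G': "deriv G z \<noteq> 0" "deriv (deriv G) z = h z * deriv G z" if "z \<in> unit_seg" for z
    using assms(1) that by (force simp: linearizer_def)+
  have Fz: "F z \<in> unit_seg" if "z \<in> unit_seg" for z
    using F(2) that by blast
  note pt = analytic_on_point[OF F(1)] analytic_on_point[OF G]
  note pt' = analytic_on_point[OF analytic_deriv[OF F(1)]] analytic_on_point[OF analytic_deriv[OF G]]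
  define \<psi> where "\<psi> z = deriv G (F z) * deriv F z / deriv G z" for z
  have "\<psi> analytic_on unit_seg"
    unfolding \<psi>_def
    by (intro analytic_intros F(1) G G' analytic_on_compose_gen[OF F(1) analytic_deriv[OF G], unfolded o_def] Fz)
  moreover have "deriv \<psi> z = 0" if z: "z \<in> unit_seg" for z
  proof (rule DERIV_imp_deriv)
    have "(\<psi> has_field_derivative
        ((deriv (deriv G) (F z) * deriv F z * deriv F z + deriv (deriv F) z * deriv G (F z)) * deriv G z
          - deriv G (F z) * deriv F z * deriv (deriv G) z) / (deriv G z * deriv G z)) (at z)"
      unfolding \<psi>_def
      by (intro DERIV_divide DERIV_mult DERIV_chain2[OF analytic_derivI] analytic_derivI pt pt' z Fz G')
    moreover have "h z = deriv (deriv F) z / deriv F z + h (F z) * deriv F z"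
      using h z by (auto simp: log_cocycle_def pre_schwarzian_def)
    then have F'': "deriv (deriv F) z = (h z - h (F z) * deriv F z) * deriv F z"
      using F(3)[OF z] by (simp add: field_simps)
    have "(deriv (deriv G) (F z) * deriv F z * deriv F z + deriv (deriv F) z * deriv G (F z)) * deriv G z
          - deriv G (F z) * deriv F z * deriv (deriv G) z = 0"
      unfolding F'' G'(2)[OF z] G'(2)[OF Fz[OF z]] by (simp add: algebra_simps)
    ultimately show "(\<psi> has_field_derivative 0) (at z)"
      by simp
  qed
  ultimately obtain l where l: "\<And>z. z \<in> unit_seg \<Longrightarrow> \<psi> z = l"
    using deriv_zero_imp_const_on_unit_seg by blast
  \<comment> \<open>At the fixed point the two factors \<open>deriv G p\<close> cancel, which
    identifies the constant as the multiplier \<open>deriv F p\<close>.\<close>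
  obtain p where p: "p \<in> unit_seg" "F p = p"
    using fixed_point_on_unit_seg[OF F(1,4,2,5)] by blast
  have "l = deriv F p"
    using l[OF p(1)] p G' by (simp add: \<psi>_def)
  then have eq: "deriv G (F z) * deriv F z = deriv F p * deriv G z" if "z \<in> unit_seg" for z
    using l[OF that] G'[OF that] by (simp add: \<psi>_def field_simps)
  define \<theta> where "\<theta> z = G (F z) - deriv F p * G z" for z
  have "\<theta> analytic_on unit_seg"
    unfolding \<theta>_def
    by (intro analytic_intros F(1) G analytic_on_compose_gen[OF F(1) G, unfolded o_def] Fz)
  moreover have "deriv \<theta> z = 0" if z: "z \<in> unit_seg" for z
  proof (rule DERIV_imp_deriv)
    have "(\<theta> has_field_derivative deriv G (F z) * deriv F z - deriv F p * deriv G z) (at z)"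
      unfolding \<theta>_def
      by (intro DERIV_diff DERIV_cmult DERIV_chain2[OF analytic_derivI] analytic_derivI pt z Fz)
    then show "(\<theta> has_field_derivative 0) (at z)"
      using eq[OF z] by simp
  qed
  ultimately obtain t where "\<And>z. z \<in> unit_seg \<Longrightarrow> \<theta> z = t"
    using deriv_zero_imp_const_on_unit_seg by blast
  then have "G (F z) = deriv F p * G z + t" if "z \<in> unit_seg" for z
    using that by (simp add: \<theta>_def diff_eq_eq add.commute)
  then show thesis
    using that p by blast
qed

section \<open>Solutions of the functional equation from conjugacies\<close>

definition semiconj :: "(complex \<Rightarrow> complex) \<Rightarrow> (complex \<Rightarrow> complex) \<Rightarrow> bool" where
  "semiconj G F \<longleftrightarrow> (\<exists>l t. l \<noteq> 0 \<and> (\<forall>z\<in>unit_seg. G (F z) = l * G z + t))"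

text \<open>Every ball around \<open>p\<close> contains a second point of the segment, where
  \<open>G\<close> takes another value.\<close>

lemma inj_on_imp_not_constant_near:
  assumes "inj_on G unit_seg" "p \<in> unit_seg" "r > 0"
  shows "\<not> G constant_on ball p r"
proof
  assume "G constant_on ball p r"
  then obtain a where a: "\<And>z. z \<in> ball p r \<Longrightarrow> G z = a"
    by (auto simp: constant_on_def)
  obtain z where "z \<in> unit_seg" "z \<noteq> p" "dist z p < r"
    using islimpt_unit_seg[OF assms(2)] assms(3) by (meson islimpt_approachable)
  then show False
    using a[of z] a[of p] assms by (auto simp: dist_commute dest: inj_onD)
qed

text \<open>The chain rule applied to \<open>G \<circ> F - l * G\<close>, which is analytic and
  constant along the segment, so its complex derivative vanishes there.\<close>

lemma deriv_semiconj:
  assumes "F analytic_on unit_seg" "F ` unit_seg \<subseteq> unit_seg" "G analytic_on unit_seg"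
    and eq: "\<And>z. z \<in> unit_seg \<Longrightarrow> G (F z) = l * G z + t" and z: "z \<in> unit_seg"
  shows "deriv G (F z) * deriv F z = l * deriv G z"
proof -
  have Fz: "F z \<in> unit_seg" if "z \<in> unit_seg" for z
    using assms(2) that by blast
  have "(\<lambda>z. G (F z) - l * G z) analytic_on unit_seg"
    by (intro analytic_intros assms(3) analytic_on_compose_gen[OF assms(1,3), unfolded o_def] Fz)
  then have "deriv (\<lambda>z. G (F z) - l * G z) z = 0"
    by (rule const_on_unit_seg_imp_deriv_zero[where a = t]) (use eq z in auto)
  moreover have "((\<lambda>z. G (F z) - l * G z) has_field_derivative
      deriv G (F z) * deriv F z - l * deriv G z) (at z)"
    by (intro DERIV_diff DERIV_cmult DERIV_chain2[OF analytic_derivI] analytic_derivI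
        analytic_on_point[OF assms(1)] analytic_on_point[OF assms(3)] z Fz)
  ultimately show ?thesis
    using DERIV_imp_deriv by fastforce
qed

text \<open>The orbit of a critical point of \<open>G\<close> consists of critical points and accumulates at the
  fixed point of \<open>F\<close>, unless it is constant.\<close>
lemma critical_point_fixed:
  assumes F: "seg_contraction c F" and G: "G analytic_on unit_seg" "inj_on G unit_seg"
    and "semiconj G F" and x: "x \<in> unit_seg" "deriv G x = 0"
  shows "F x = x"
proof (rule ccontr)
  assume neq: "F x \<noteq> x"
  have Fa: "F analytic_on unit_seg" "F ` unit_seg \<subseteq> unit_seg" "c < 1"
    and Fb: "\<And>z. z \<in> unit_seg \<Longrightarrow> deriv F z \<noteq> 0" "\<And>z. z \<in> unit_seg \<Longrightarrow> cmod (deriv F z) \<le> c"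
    using F by (auto simp: seg_contraction_def)
  obtain l t where l: "l \<noteq> 0" "\<And>z. z \<in> unit_seg \<Longrightarrow> G (F z) = l * G z + t"
    using assms by (auto simp: semiconj_def)
  \<comment> \<open>Injectivity of \<open>F\<close> is inherited from \<open>G\<close> because
    \<open>l\<close> is nonzero. It keeps the orbit of \<open>x\<close> from ever reaching the fixed
    point \<open>p\<close>.\<close>
  have inj: "inj_on F unit_seg"
  proof (rule inj_onI)
    fix a b assume ab: "a \<in> unit_seg" "b \<in> unit_seg" "F a = F b"
    then have "l * G a = l * G b"
      by (metis l(2) add_right_cancel)
    then show "a = b"
      using l(1) G(2) ab by (auto dest: inj_onD)
  qed
  obtain p where p: "p \<in> unit_seg" "F p = p"
    using fixed_point_on_unit_seg[OF Fa(1) Fb(2) Fa(2,3)] by blast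
  have orbit: "(F ^^ n) x \<in> unit_seg \<and> (F ^^ n) x \<noteq> p \<and> deriv G ((F ^^ n) x) = 0
      \<and> dist ((F ^^ n) x) p \<le> c ^ n * dist x p" for n
  proof (induction n)
    case 0
    then show ?case using x neq p by auto
  next
    case (Suc n)
    let ?y = "(F ^^ n) x"
    have y: "?y \<in> unit_seg" "?y \<noteq> p" "deriv G ?y = 0" "dist ?y p \<le> c ^ n * dist x p"
      using Suc by auto
    have "0 \<le> c"
      using Fb(2)[OF x(1)] norm_ge_zero order_trans by blast
    have "dist (F ?y) (F p) \<le> c * dist ?y p"
      by (rule contraction_on_unit_seg[OF Fa(1) Fb(2) y(1) p(1)])
    also have "\<dots> \<le> c * (c ^ n * dist x p)"
      using y(4) \<open>0 \<le> c\<close> by (rule mult_left_mono)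
    finally have "dist (F ?y) p \<le> c ^ Suc n * dist x p"
      using p by (simp add: mult.assoc)
    moreover have "F ?y \<noteq> p"
      using inj_onD[OF inj, of ?y p] y p by auto
    moreover have "deriv G (F ?y) = 0"
      using deriv_semiconj[OF Fa(1,2) G(1) l(2) y(1)] y(3) Fb(1)[OF y(1)] by auto
    ultimately show ?case
      using y(1) Fa(2) by auto
  qed
  obtain r where r: "r > 0" "G holomorphic_on ball p r"
    using G(1) p(1) by (auto simp: analytic_on_def)
  have "(\<lambda>n. c ^ n * dist x p) \<longlonglongrightarrow> 0 * dist x p"
    using Fa(3) Fb(2)[OF x(1)] norm_ge_zero[of "deriv F x"]
    by (intro tendsto_mult_right LIMSEQ_realpow_zero) linarith+
  then have small: "\<exists>n. c ^ n * dist x p < e" if "e > 0" for e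
    using that order_tendstoD(2)[of _ "0 * dist x p" sequentially e]
    by (auto simp: eventually_sequentially)
  \<comment> \<open>The orbit points close to \<open>p\<close>: zeros of \<open>deriv G\<close>
    accumulating at \<open>p\<close>. The identity theorem then makes \<open>deriv G\<close> vanish
    on the whole ball, against the injectivity of \<open>G\<close>.\<close>
  define Z where "Z = ball p r \<inter> range (\<lambda>n. (F ^^ n) x)"
  have "p islimpt Z"
    unfolding islimpt_approachable
  proof (intro allI impI)
    fix e :: real assume "e > 0"
    then obtain n where n: "c ^ n * dist x p < min e r"
      using small[of "min e r"] r by auto
    then have "(F ^^ n) x \<in> Z" "(F ^^ n) x \<noteq> p" "dist ((F ^^ n) x) p < e"
      using orbit[of n] by (auto simp: Z_def dist_commute)
    then show "\<exists>z\<in>Z. z \<noteq> p \<and> dist z p < e"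
      by blast
  qed
  then have "deriv G z = 0" if "z \<in> ball p r" for z
    using that r orbit
    by (intro analytic_continuation[of "deriv G" "ball p r" Z p z] holomorphic_deriv) (auto simp: Z_def)
  then have "(G has_field_derivative 0) (at z within ball p r)" if "z \<in> ball p r" for z
    using holomorphic_derivI[OF r(2) open_ball that] that by metis
  then have "G constant_on ball p r"
    using has_field_derivative_zero_constant[of "ball p r" G] by (auto simp: constant_on_def)
  then show False
    using inj_on_imp_not_constant_near[OF G(2) p(1) r(1)] by blast
qed

text \<open>If \<open>G\<close> has a critical point \<open>p\<close> of order \<open>n - 1\<close>, then \<open>G - G p\<close> is up to a constant the
  \<open>n\<close>-th power of the linearising coordinate \<open>\<phi>\<close> at \<open>p\<close>; \<open>v\<close> is then a multiple of \<open>\<phi>' ^ n\<close>.\<close>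
lemma semiconj_imp_multiplicative_cocycle:
  assumes F: "\<And>F. F \<in> S \<Longrightarrow> seg_contraction c F" and "S \<noteq> {}"
    and G: "G analytic_on unit_seg" "inj_on G unit_seg"
    and semi: "\<And>F. F \<in> S \<Longrightarrow> semiconj G F"
  obtains v n where "n > 0" "v analytic_on unit_seg" "\<And>z. z \<in> unit_seg \<Longrightarrow> v z \<noteq> 0"
    "\<And>F. F \<in> S \<Longrightarrow> \<exists>l. l \<noteq> 0 \<and> (\<forall>z\<in>unit_seg. v (F z) * deriv F z ^ n = l * v z)"
proof (cases "\<exists>p\<in>unit_seg. deriv G p = 0")
  \<comment> \<open>Without critical points the differentiated conjugacy relation is already of the
    required form, with \<open>n = 1\<close> and \<open>v = deriv G\<close>.\<close>
  case False
  have "\<exists>l. l \<noteq> 0 \<and> (\<forall>z\<in>unit_seg. deriv G (F z) * deriv F z ^ 1 = l * deriv G z)" if FS: "F \<in> S" for F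
  proof -
    obtain l t where "l \<noteq> 0" "\<And>z. z \<in> unit_seg \<Longrightarrow> G (F z) = l * G z + t"
      using semi[OF FS] by (auto simp: semiconj_def)
    then show ?thesis
      using deriv_semiconj[of F G l t] F[OF FS] G by (auto simp: seg_contraction_def)
  qed
  then show thesis
    using that[of 1 "deriv G"] False G analytic_deriv by auto
next
  case True
  then obtain p where p: "p \<in> unit_seg" "deriv G p = 0" by blast
  have fix_p: "F p = p" if "F \<in> S" for F
    using critical_point_fixed[OF F[OF that] G semi[OF that] p] .
  have G'nz: "deriv G z \<noteq> 0" if "z \<in> unit_seg" "z \<noteq> p" for z
  proof
    assume "deriv G z = 0"
    obtain F where "F \<in> S" using \<open>S \<noteq> {}\<close> by blast
    have "F z = z"
      using critical_point_fixed[OF F[OF \<open>F \<in> S\<close>] G semi[OF \<open>F \<in> S\<close>] that(1) \<open>deriv G z = 0\<close>] .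
    then show False
      using fixed_point_on_unit_seg[of F c] F[OF \<open>F \<in> S\<close>] fix_p[OF \<open>F \<in> S\<close>] that p
      by (auto simp: seg_contraction_def)
  qed
  obtain r0 where r0: "r0 > 0" "G holomorphic_on ball p r0"
    using G(1) p(1) by (auto simp: analytic_on_def)
  have nonconst: "\<not> (\<lambda>z. G z - G p) constant_on ball p r0"
  proof
    assume "(\<lambda>z. G z - G p) constant_on ball p r0"
    then have "G constant_on ball p r0"
      by (auto simp: constant_on_def diff_eq_eq)
    then show False
      using inj_on_imp_not_constant_near[OF G(2) p(1) r0(1)] by blast
  qed
  have "(\<lambda>z. G z - G p) holomorphic_on ball p r0" "p \<in> ball p r0" "G p - G p = 0"
    using r0 by (auto intro!: holomorphic_intros)
  note factor = holomorphic_factor_zero_nonconstant[OF this(1) open_ball connected_ball this(2,3) nonconst]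
  obtain u r n where u: "0 < n" "0 < r" "ball p r \<subseteq> ball p r0" "u holomorphic_on ball p r"
    "\<And>w. w \<in> ball p r \<Longrightarrow> G w - G p = (w - p) ^ n * u w" "\<And>w. w \<in> ball p r \<Longrightarrow> u w \<noteq> 0"
    by (rule factor) (rule that)
  \<comment> \<open>With \<open>G - G p = \<phi> ^ n\<close> one has
    \<open>G' = n * \<phi> ^ (n - 1) * \<phi>'\<close>, so the quotient is
    \<open>n ^ n * \<phi>' ^ n\<close>, regular and nonzero at \<open>p\<close>. The separate value
    at \<open>p\<close> is the limit that removes the singularity.\<close>
  define v where "v z = (if z = p then of_nat n ^ n * u p else deriv G z ^ n / (G z - G p) ^ (n - 1))" for z
  \<comment> \<open>The same quotient after inserting \<open>G - G p = (z - p) ^ n * u\<close> and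
    cancelling the powers of \<open>z - p\<close>; it is visibly holomorphic near
    \<open>p\<close>.\<close>
  define v0 where "v0 z = (of_nat n * u z + (z - p) * deriv u z) ^ n / u z ^ (n - 1)" for z
  have v_eq: "v z = v0 z" if z: "z \<in> ball p r" for z
  proof (cases "z = p")
    case True
    have "u p ^ n = u p * u p ^ (n - 1)"
      using power_minus_mult[OF u(1), of "u p"] by (simp add: mult.commute)
    then show ?thesis
      using True u(2,6) by (simp add: v_def v0_def power_mult_distrib)
  next
    case False
    have "((\<lambda>w. (w - p) ^ n * u w) has_field_derivative
        of_nat n * (z - p) ^ (n - 1) * u z + deriv u z * (z - p) ^ n) (at z)"
      by (rule derivative_eq_intros refl holomorphic_derivI[OF u(4) open_ball z])+ simp
    then have "((\<lambda>w. G w - G p) has_field_derivative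
        of_nat n * (z - p) ^ (n - 1) * u z + deriv u z * (z - p) ^ n) (at z)"
      by (rule has_field_derivative_transform_within_open[OF _ open_ball z]) (simp add: u)
    moreover have "((\<lambda>w. G w - G p) has_field_derivative deriv G z - 0) (at z)"
      using holomorphic_derivI[OF r0(2) open_ball] z u(3) by (intro DERIV_diff DERIV_const) blast
    ultimately have "deriv G z = of_nat n * (z - p) ^ (n - 1) * u z + deriv u z * (z - p) ^ n"
      using DERIV_unique by fastforce
    also have "(z - p) ^ n = (z - p) ^ (n - 1) * (z - p)"
      by (simp only: power_minus_mult[OF u(1)])
    finally have "deriv G z = (z - p) ^ (n - 1) * (of_nat n * u z + (z - p) * deriv u z)"
      by (simp add: algebra_simps)
    then have "v z = ((z - p) ^ (n - 1)) ^ n * (of_nat n * u z + (z - p) * deriv u z) ^ n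
        / (((z - p) ^ n) ^ (n - 1) * u z ^ (n - 1))"
      using False u(5)[OF z] by (simp add: v_def power_mult_distrib)
    also have "((z - p) ^ (n - 1)) ^ n = ((z - p) ^ n) ^ (n - 1)"
      by (simp add: mult.commute flip: power_mult)
    finally show ?thesis
      using False by (simp add: v0_def)
  qed
  have inj_p: "G z \<noteq> G p" if "z \<in> unit_seg" "z \<noteq> p" for z
    using G(2) that p by (auto dest: inj_onD)
  have v_nz: "v z \<noteq> 0" if "z \<in> unit_seg" for z
    using that u G'nz inj_p by (auto simp: v_def)
  have v_an: "v analytic_on unit_seg"
    unfolding analytic_on_analytic_at[of v unit_seg]
  proof
    fix z assume z: "z \<in> unit_seg"
    show "v analytic_on {z}"
    proof (cases "z = p")
      case True
      have "v0 holomorphic_on ball p r"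
        unfolding v0_def using u by (intro holomorphic_intros) auto
      then have "v holomorphic_on ball p r"
        by (rule holomorphic_transform) (simp add: v_eq)
      then show ?thesis
        using True u(2) open_ball centre_in_ball analytic_at[of v z] by blast
    next
      case False
      have "(\<lambda>z. deriv G z ^ n / (G z - G p) ^ (n - 1)) analytic_on {z}"
        using inj_p[OF z False] analytic_on_point[OF G(1) z] by (intro analytic_intros) auto
      moreover have "\<forall>\<^sub>F w in nhds z. deriv G w ^ n / (G w - G p) ^ (n - 1) = v w"
        using t1_space_nhds[OF False] by eventually_elim (simp add: v_def)
      ultimately show ?thesis
        using analytic_at_cong[OF _ refl] by metis
    qed
  qed
  have "\<exists>l. l \<noteq> 0 \<and> (\<forall>z\<in>unit_seg. v (F z) * deriv F z ^ n = l * v z)" if FS: "F \<in> S" for F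
  proof -
    obtain l t where l: "l \<noteq> 0" "\<And>z. z \<in> unit_seg \<Longrightarrow> G (F z) = l * G z + t"
      using semi[OF FS] by (auto simp: semiconj_def)
    have Fa: "F analytic_on unit_seg" "F ` unit_seg \<subseteq> unit_seg"
      using F[OF FS] by (auto simp: seg_contraction_def)
    have off_p: "v (F z) * deriv F z ^ n - l * v z = 0" if z: "z \<in> unit_seg" "z \<noteq> p" for z
    proof -
      have e: "G (F z) - G p = l * (G z - G p)"
        using l(2)[OF z(1)] l(2)[OF p(1)] fix_p[OF FS] by (simp add: algebra_simps)
      have ne: "G (F z) - G p \<noteq> 0"
        unfolding e using l(1) inj_p[OF z] by simp
      then have "F z \<noteq> p" by auto
      then have "v (F z) * deriv F z ^ n = (deriv G (F z) * deriv F z) ^ n / (G (F z) - G p) ^ (n - 1)"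
        by (simp add: v_def power_mult_distrib)
      also have "\<dots> = (l * deriv G z) ^ n / (l * (G z - G p)) ^ (n - 1)"
        by (simp only: e deriv_semiconj[OF Fa G(1) l(2) z(1)])
      \<comment> \<open>The quotient \<open>v\<close> is homogeneous of degree
        \<open>n - (n - 1) = 1\<close> in \<open>G - G p\<close>, so it picks up the single factor
        \<open>l\<close>.\<close>
      also have "\<dots> = l ^ n / l ^ (n - 1) * v z"
        using z(2) by (simp add: v_def power_mult_distrib)
      also have "l ^ n / l ^ (n - 1) = l"
        using l(1) power_minus_mult[OF u(1), of l] by (simp add: divide_eq_eq mult.commute)
      finally show ?thesis by simp
    qed
    have "(\<lambda>z. v (F z) * deriv F z ^ n - l * v z) analytic_on unit_seg"
      using Fa(2) by (intro analytic_intros v_an Fa(1) analytic_on_compose_gen[OF Fa(1) v_an, unfolded o_def]) auto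
    then have "continuous_on unit_seg (\<lambda>z. v (F z) * deriv F z ^ n - l * v z)"
      by (rule analytic_imp_holomorphic[THEN holomorphic_on_imp_continuous_on])
    then have "((\<lambda>z. v (F z) * deriv F z ^ n - l * v z) \<longlongrightarrow> v (F p) * deriv F p ^ n - l * v p) (at p within unit_seg)"
      using p(1) by (auto simp: continuous_on_def)
    \<comment> \<open>The relation is known away from \<open>p\<close>, where the difference is 0;
      continuity carries it to \<open>p\<close>.\<close>
    moreover have "((\<lambda>z. v (F z) * deriv F z ^ n - l * v z) \<longlongrightarrow> 0) (at p within unit_seg)"
      by (rule tendsto_eventually, unfold eventually_at_filter, rule always_eventually)
         (use off_p in blast)
    ultimately have "v (F p) * deriv F p ^ n - l * v p = 0"
      using islimpt_unit_seg[OF p(1)] by (intro tendsto_unique) (auto simp: trivial_limit_within)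
    then have "v (F z) * deriv F z ^ n = l * v z" if "z \<in> unit_seg" for z
      using off_p[OF that] by (cases "z = p") auto
    then show ?thesis
      using l(1) by blast
  qed
  then show thesis
    using that u(1) v_an v_nz by blast
qed

text \<open>Taking logarithmic derivatives of \<open>v (F z) * F' z ^ n = l * v z\<close> and
  dividing by \<open>n\<close> gives the functional equation for \<open>q = v' / (n * v)\<close>.
  The factor \<open>l\<close> disappears, so one \<open>q\<close> serves all maps of
  \<open>S\<close>.\<close>

lemma semiconj_imp_log_cocycle:
  assumes F: "\<And>F. F \<in> S \<Longrightarrow> seg_contraction c F" and "S \<noteq> {}"
    and G: "G analytic_on unit_seg" "inj_on G unit_seg"
    and semi: "\<And>F. F \<in> S \<Longrightarrow> semiconj G F"
  obtains q where "continuous_on unit_seg q" "\<And>F. F \<in> S \<Longrightarrow> log_cocycle F q"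
proof -
  obtain v n where v: "n > 0" "v analytic_on unit_seg" "\<And>z. z \<in> unit_seg \<Longrightarrow> v z \<noteq> 0"
    "\<And>F. F \<in> S \<Longrightarrow> \<exists>l. l \<noteq> 0 \<and> (\<forall>z\<in>unit_seg. v (F z) * deriv F z ^ n = l * v z)"
    by (rule semiconj_imp_multiplicative_cocycle[OF F assms(2) G semi]) (assumption+, rule that)
  define q where "q z = deriv v z / (of_nat n * v z)" for z
  have "q analytic_on unit_seg"
    unfolding q_def using v(1-3) by (intro analytic_intros) auto
  then have "continuous_on unit_seg q"
    by (rule analytic_imp_holomorphic[THEN holomorphic_on_imp_continuous_on])
  moreover have "log_cocycle F q" if FS: "F \<in> S" for F
    unfolding log_cocycle_def
  proof
    fix z assume z: "z \<in> unit_seg"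
    obtain l where l: "l \<noteq> 0" "\<And>z. z \<in> unit_seg \<Longrightarrow> v (F z) * deriv F z ^ n = l * v z"
      using v(4)[OF FS] by blast
    have Fa: "F analytic_on unit_seg" "F ` unit_seg \<subseteq> unit_seg" "deriv F z \<noteq> 0"
      using F[OF FS] z by (auto simp: seg_contraction_def)
    have Fz: "F z \<in> unit_seg" using Fa z by blast
    define P where "P z = v (F z) * deriv F z ^ n - l * v z" for z
    have "P analytic_on unit_seg"
      unfolding P_def
      using Fa(2) by (intro analytic_intros v Fa(1) analytic_on_compose_gen[OF Fa(1) v(2), unfolded o_def]) auto
    then have "deriv P z = 0"
      by (rule const_on_unit_seg_imp_deriv_zero[where a = 0]) (use l z in \<open>auto simp: P_def\<close>)
    moreover have "(P has_field_derivative
        deriv v (F z) * deriv F z * deriv F z ^ n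
        + of_nat n * (deriv (deriv F) z * deriv F z ^ (n - Suc 0)) * v (F z) - l * deriv v z) (at z)"
      unfolding P_def
      by (intro DERIV_diff DERIV_cmult DERIV_mult DERIV_power DERIV_chain2[OF analytic_derivI] analytic_derivI
          analytic_on_point[OF Fa(1)] analytic_on_point[OF analytic_deriv[OF Fa(1)]] analytic_on_point[OF v(2)] z Fz)
    ultimately have e: "deriv v (F z) * deriv F z * deriv F z ^ n
        + of_nat n * (deriv (deriv F) z * deriv F z ^ (n - Suc 0)) * v (F z) = l * deriv v z"
      using DERIV_imp_deriv by fastforce
    have pw: "deriv F z ^ n = deriv F z * deriv F z ^ (n - Suc 0)"
      using power_minus_mult[OF v(1), of "deriv F z"] by (simp add: mult.commute)
    have nz: "deriv F z ^ (n - Suc 0) \<noteq> 0" "v z \<noteq> 0" "v (F z) \<noteq> 0" "(of_nat n :: complex) \<noteq> 0"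
      using v(1) v(3)[OF z] v(3)[OF Fz] Fa(3) by auto
    \<comment> \<open>The undifferentiated relation eliminates \<open>l\<close> from the
      differentiated one.\<close>
    have l_eq: "l = v (F z) * deriv F z ^ n / v z"
      using l(2)[OF z] nz by (simp add: field_simps)
    have "deriv F z ^ (n - Suc 0) * (deriv F z * (deriv v z * v (F z))) =
        deriv F z ^ (n - Suc 0) * (v z * (of_nat n * (deriv (deriv F) z * v (F z))
          + deriv F z * deriv F z * deriv v (F z)))"
      using e nz unfolding l_eq pw by (simp add: field_simps)
    then have "deriv F z * (deriv v z * v (F z)) =
        v z * (of_nat n * (deriv (deriv F) z * v (F z)) + deriv F z * deriv F z * deriv v (F z))"
      using nz(1) by (simp only: mult_cancel_left) simp
    moreover have "x' / (m * x) = d' / d + y' / (m * y) * d"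
      if "d * (x' * y) = x * (m * (d' * y) + d * d * y')" "d \<noteq> 0" "x \<noteq> 0" "y \<noteq> 0" "m \<noteq> 0"
      for d d' x x' y y' m :: complex
      using that by (simp add: field_simps)
    ultimately show "q z = pre_schwarzian F z + q (F z) * deriv F z"
      unfolding q_def pre_schwarzian_def using nz Fa(3) by blast
  qed
  ultimately show thesis
    using that by blast
qed

text \<open>The difference \<open>d\<close> of two solutions satisfies
  \<open>d z = d (F z) * deriv F z\<close>. Iterating along the orbit bounds it by
  \<open>c ^ n * B\<close> for every \<open>n\<close>.\<close>

lemma log_cocycle_unique:
  assumes F: "seg_contraction c F" and "log_cocycle F q" "log_cocycle F q'"
    and "bounded (q ` unit_seg)" "bounded (q' ` unit_seg)" and z: "z \<in> unit_seg"
  shows "q z = q' z"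
proof -
  obtain B where B: "\<And>z. z \<in> unit_seg \<Longrightarrow> cmod (q z - q' z) \<le> B"
  proof -
    obtain b b' where "\<forall>z\<in>unit_seg. cmod (q z) \<le> b" "\<forall>z\<in>unit_seg. cmod (q' z) \<le> b'"
      using assms(4,5) by (auto simp: bounded_iff)
    then have "cmod (q z - q' z) \<le> b + b'" if "z \<in> unit_seg" for z
      using that norm_triangle_ineq4[of "q z" "q' z"] by fastforce
    then show thesis using that by blast
  qed
  have c: "0 \<le> c" "c < 1"
    using order_trans[OF norm_ge_zero, of "deriv F z" c] F z by (auto simp: seg_contraction_def)
  have "cmod (q z - q' z) \<le> c ^ n * B" if "z \<in> unit_seg" for z n
    using that
  proof (induction n arbitrary: z)
    case 0
    then show ?case using B by simp
  next
    case (Suc n)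
    have Fz: "F z \<in> unit_seg" "cmod (deriv F z) \<le> c"
      using F Suc.prems by (auto simp: seg_contraction_def)
    have "q z - q' z = (q (F z) - q' (F z)) * deriv F z"
      using assms(2,3) Suc.prems by (simp add: log_cocycle_def algebra_simps)
    then have "cmod (q z - q' z) = cmod (q (F z) - q' (F z)) * cmod (deriv F z)"
      by (simp add: norm_mult)
    also have "\<dots> \<le> (c ^ n * B) * c"
      using Suc.IH[OF Fz(1)] Fz(2) by (intro mult_mono) (use c norm_ge_zero order_trans in blast)+
    finally show ?case by (simp add: mult_ac)
  qed
  moreover have "(\<lambda>n. c ^ n * B) \<longlonglongrightarrow> 0 * B"
    using c by (intro tendsto_mult_right LIMSEQ_realpow_zero)
  ultimately have "cmod (q z - q' z) \<le> 0 * B"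
    using z by (meson Lim_bounded2 LIMSEQ_le_const)
  then show ?thesis by simp
qed

section \<open>The series H of an iterated function system\<close>

text \<open>The logarithmic derivative of the product \<open>(G' \<circ> F) * F'\<close>.\<close>

lemma pre_schwarzian_compose:
  assumes F: "F holomorphic_on U" and G: "G holomorphic_on U" and U: "open U"
    and FU: "\<And>z. z \<in> U \<Longrightarrow> F z \<in> U" and z: "z \<in> U"
    and nz: "deriv F z \<noteq> 0" "deriv G (F z) \<noteq> 0"
  shows "pre_schwarzian (\<lambda>w. G (F w)) z = pre_schwarzian F z + pre_schwarzian G (F z) * deriv F z"
proof -
  have d: "deriv (\<lambda>w. G (F w)) w = deriv G (F w) * deriv F w" if "w \<in> U" for w
    by (intro DERIV_imp_deriv DERIV_chain2[of G _ F] holomorphic_derivI[OF F U]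
        holomorphic_derivI[OF G U] FU that)
  have "((\<lambda>w. deriv G (F w) * deriv F w) has_field_derivative
      deriv (deriv G) (F z) * deriv F z * deriv F z + deriv (deriv F) z * deriv G (F z)) (at z)"
    by (intro DERIV_mult DERIV_chain2[of "deriv G" _ F]
        holomorphic_derivI[OF holomorphic_deriv[OF G U] U FU[OF z]]
        holomorphic_derivI[OF holomorphic_deriv[OF F U] U z] holomorphic_derivI[OF F U z])
  then have "(deriv (\<lambda>w. G (F w)) has_field_derivative
      deriv (deriv G) (F z) * deriv F z * deriv F z + deriv (deriv F) z * deriv G (F z)) (at z)"
    by (rule has_field_derivative_transform_within_open[OF _ U z]) (simp only: d)
  then have "deriv (deriv (\<lambda>w. G (F w))) z =
      deriv (deriv G) (F z) * deriv F z * deriv F z + deriv (deriv F) z * deriv G (F z)"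
    by (rule DERIV_imp_deriv)
  then show ?thesis
    using nz by (simp add: pre_schwarzian_def d[OF z] add_divide_distrib)
qed

text \<open>Holomorphic extensions that map one common neighbourhood into itself, so that all
  compositions are defined there. The constants \<open>c\<close> and \<open>M\<close> are uniform in
  the map and the point, which gives the series a geometric majorant.\<close>

locale complex_ifs =
  fixes \<epsilon> c M :: real and N :: nat and \<Phi> :: "(real \<Rightarrow> real) list"
    and Fs :: "nat \<Rightarrow> complex \<Rightarrow> complex"
  assumes eps: "\<epsilon> > 0" and c: "0 \<le> c" "c < 1"
    and seg: "\<And>k x. k < N \<Longrightarrow> x \<in> {0..1} \<Longrightarrow> (\<Phi> ! k) x \<in> {0..1}"
    and hol: "\<And>k. k < N \<Longrightarrow> Fs k holomorphic_on nbhd \<epsilon>"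
    and into: "\<And>k z. k < N \<Longrightarrow> z \<in> nbhd \<epsilon> \<Longrightarrow> Fs k z \<in> nbhd \<epsilon>"
    and ext: "\<And>k x. k < N \<Longrightarrow> complex_of_real x \<in> nbhd \<epsilon> \<Longrightarrow>
        Fs k (of_real x) = of_real ((\<Phi> ! k) x)"
    and deriv_nz: "\<And>k z. k < N \<Longrightarrow> z \<in> nbhd \<epsilon> \<Longrightarrow> deriv (Fs k) z \<noteq> 0"
    and deriv_le: "\<And>k z. k < N \<Longrightarrow> z \<in> nbhd \<epsilon> \<Longrightarrow> cmod (deriv (Fs k) z) \<le> c"
    and psz_le: "\<And>k z. k < N \<Longrightarrow> z \<in> nbhd \<epsilon> \<Longrightarrow> cmod (pre_schwarzian (Fs k) z) \<le> M"
begin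

section \<open>Compositions along words\<close>

definition FW :: "nat list \<Rightarrow> complex \<Rightarrow> complex" where
  "FW w = foldr (\<lambda>k h. Fs k \<circ> h) w id"

lemma FW_simps [simp]: "FW [] = (\<lambda>z. z)" "FW (k # w) = (\<lambda>z. Fs k (FW w z))"
  by (simp_all add: FW_def fun_eq_iff)

lemma word_map_simps [simp]: "word_map \<Phi> [] = (\<lambda>x. x)"
  "word_map \<Phi> (k # w) = (\<lambda>x. (\<Phi> ! k) (word_map \<Phi> w x))"
  by (simp_all add: word_map_def fun_eq_iff)

lemma FW_append: "FW (u @ w) = (\<lambda>z. FW u (FW w z))"
  by (induction u) auto

lemma words_simps [simp]: "[] \<in> words N" "k # w \<in> words N \<longleftrightarrow> k < N \<and> w \<in> words N"
  by (auto simp: words_def)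

lemma FW_props:
  assumes "w \<in> words N"
  shows FW_hol: "FW w holomorphic_on nbhd \<epsilon>"
    and FW_into: "\<And>z. z \<in> nbhd \<epsilon> \<Longrightarrow> FW w z \<in> nbhd \<epsilon>"
    and FW_ext: "\<And>x. complex_of_real x \<in> nbhd \<epsilon> \<Longrightarrow> FW w (of_real x) = of_real (word_map \<Phi> w x)"
    and word_map_seg: "\<And>x. x \<in> {0..1} \<Longrightarrow> word_map \<Phi> w x \<in> {0..1}"
proof -
  have "FW w holomorphic_on nbhd \<epsilon> \<and> (\<forall>z\<in>nbhd \<epsilon>. FW w z \<in> nbhd \<epsilon>) \<and>
      (\<forall>x. complex_of_real x \<in> nbhd \<epsilon> \<longrightarrow> FW w (of_real x) = of_real (word_map \<Phi> w x)) \<and>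
      (\<forall>x\<in>{0..1}. word_map \<Phi> w x \<in> {0..1})"
    using assms
  proof (induction w)
    case Nil
    then show ?case by (simp add: id_def)
  next
    case (Cons k w)
    then have k: "k < N" and IH: "FW w holomorphic_on nbhd \<epsilon>"
        "\<And>z. z \<in> nbhd \<epsilon> \<Longrightarrow> FW w z \<in> nbhd \<epsilon>"
        "\<And>x. complex_of_real x \<in> nbhd \<epsilon> \<Longrightarrow> FW w (of_real x) = of_real (word_map \<Phi> w x)"
        "\<And>x. x \<in> {0..1} \<Longrightarrow> word_map \<Phi> w x \<in> {0..1}"
      by auto
    have "(\<lambda>z. Fs k (FW w z)) holomorphic_on nbhd \<epsilon>"
      using IH(2) holomorphic_on_compose_gen[OF IH(1) hol[OF k]] by (auto simp: o_def)
    moreover have "Fs k (FW w (of_real x)) = of_real ((\<Phi> ! k) (word_map \<Phi> w x))"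
      if "complex_of_real x \<in> nbhd \<epsilon>" for x
      using IH(2)[OF that] IH(3)[OF that] ext[OF k] by simp
    ultimately show ?case
      using into[OF k] IH(2,4) seg[OF k] by simp
  qed
  then show "FW w holomorphic_on nbhd \<epsilon>" "\<And>z. z \<in> nbhd \<epsilon> \<Longrightarrow> FW w z \<in> nbhd \<epsilon>"
    "\<And>x. complex_of_real x \<in> nbhd \<epsilon> \<Longrightarrow> FW w (of_real x) = of_real (word_map \<Phi> w x)"
    "\<And>x. x \<in> {0..1} \<Longrightarrow> word_map \<Phi> w x \<in> {0..1}"
    by blast+
qed

lemma deriv_FW_compose:
  assumes "u \<in> words N" "w \<in> words N" "z \<in> nbhd \<epsilon>"
  shows "deriv (\<lambda>z. FW u (FW w z)) z = deriv (FW u) (FW w z) * deriv (FW w) z"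
  by (intro DERIV_imp_deriv DERIV_chain2[of "FW u" _ "FW w"]
      holomorphic_derivI[OF FW_hol open_nbhd] FW_into assms)

lemma deriv_FW:
  assumes "w \<in> words N" "z \<in> nbhd \<epsilon>"
  shows "deriv (FW w) z \<noteq> 0 \<and> cmod (deriv (FW w) z) \<le> c ^ length w"
  using assms(1)
proof (induction w)
  case Nil
  then show ?case by (simp add: id_def)
next
  case (Cons k w)
  then have k: "k < N" "w \<in> words N" by auto
  have "deriv (FW (k # w)) z = deriv (Fs k) (FW w z) * deriv (FW w) z"
    using deriv_FW_compose[of "[k]" w z] k assms(2) by simp
  moreover have "FW w z \<in> nbhd \<epsilon>"
    using FW_into k assms(2) by blast
  moreover have "cmod (deriv (Fs k) (FW w z)) * cmod (deriv (FW w) z) \<le> c * c ^ length w"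
    using Cons.IH k deriv_le[OF k(1) \<open>FW w z \<in> nbhd \<epsilon>\<close>] c by (intro mult_mono) auto
  ultimately show ?case
    using Cons.IH k deriv_nz by (simp add: norm_mult)
qed

lemma seg_nbhd: "z \<in> unit_seg \<Longrightarrow> z \<in> nbhd \<epsilon>"
  using eps unit_seg_subset_nbhd by blast

lemma FW_unit_seg:
  assumes "w \<in> words N" "z \<in> unit_seg"
  shows "FW w z \<in> unit_seg"
proof -
  obtain x where x: "z = of_real x" "x \<in> {0..1}"
    using assms by (auto simp: unit_seg_def)
  show ?thesis
    using FW_ext[OF assms(1), of x] word_map_seg[OF assms(1) x(2)] seg_nbhd[OF assms(2)] x
    by (auto simp: unit_seg_def)
qed

lemma seg_contraction_FW:
  assumes "w \<in> words N" "w \<noteq> []"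
  shows "seg_contraction c (FW w)"
  unfolding seg_contraction_def
proof (intro conjI ballI)
  fix z assume z: "z \<in> unit_seg"
  have "cmod (deriv (FW w) z) \<le> c ^ length w"
    using deriv_FW[OF assms(1) seg_nbhd[OF z]] by blast
  also have "\<dots> \<le> c"
    using assms(2) c power_decreasing[of 1 "length w" c] by (simp add: Suc_le_eq)
  finally show "cmod (deriv (FW w) z) \<le> c" .
qed (use assms deriv_FW seg_nbhd FW_unit_seg analytic_on_unit_seg[OF FW_hol eps] c in auto)

section \<open>The series on the complex neighbourhood\<close>

lemma rev_prefix_Suc: "rev_prefix i (Suc n) = i n # rev_prefix i n"
  by (simp add: rev_prefix_def)

text \<open>Later letters act on the outside, so the first letter is the innermost map. Splitting it
  off underlies the shift equation for the series.\<close>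

lemma rev_prefix_Suc_shift: "rev_prefix i (Suc n) = rev_prefix (\<lambda>k. i (Suc k)) n @ [i 0]"
proof -
  have "map i [0..<Suc n] = i 0 # map (\<lambda>k. i (Suc k)) [0..<n]"
    by (simp only: upt_conv_Cons[OF zero_less_Suc] map_Suc_upt[symmetric] list.map map_map o_def)
  then show ?thesis
    by (simp add: rev_prefix_def del: upt_Suc)
qed

lemma rev_prefix_words: "i \<in> infwords N \<Longrightarrow> rev_prefix i n \<in> words N"
  by (auto simp: rev_prefix_def words_def infwords_def)

lemma infwords_less: "i \<in> infwords N \<Longrightarrow> i n < N"
  unfolding infwords_def by fastforce

text \<open>The holomorphic extension of the term with index \<open>n\<close> of \<open>H\<close>;
  the quotient of derivatives becomes the pre-Schwarzian.\<close>

definition TC :: "(nat \<Rightarrow> nat) \<Rightarrow> nat \<Rightarrow> complex \<Rightarrow> complex" where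
  "TC i n z = pre_schwarzian (Fs (i n)) (FW (rev_prefix i n) z) * deriv (FW (rev_prefix i n)) z"

definition HC :: "(nat \<Rightarrow> nat) \<Rightarrow> complex \<Rightarrow> complex" where
  "HC i z = (\<Sum>n. TC i n z)"

lemma holomorphic_TC:
  assumes "i \<in> infwords N" shows "TC i n holomorphic_on nbhd \<epsilon>"
proof -
  have k: "i n < N" and w: "rev_prefix i n \<in> words N"
    using assms infwords_less rev_prefix_words by auto
  have "pre_schwarzian (Fs (i n)) holomorphic_on nbhd \<epsilon>"
    unfolding pre_schwarzian_def
    by (intro holomorphic_intros holomorphic_deriv hol k open_nbhd deriv_nz)
  then have "pre_schwarzian (Fs (i n)) \<circ> FW (rev_prefix i n) holomorphic_on nbhd \<epsilon>"
    using FW_into[OF w] by (intro holomorphic_on_compose_gen[OF FW_hol[OF w]]) auto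
  then show ?thesis
    unfolding TC_def o_def by (intro holomorphic_intros holomorphic_deriv FW_hol w open_nbhd)
qed

text \<open>The prefix has exactly \<open>n\<close> letters, so the derivative factor is at most
  \<open>c ^ n\<close>, while the pre-Schwarzian is at most \<open>M\<close>.\<close>

lemma norm_TC_le:
  assumes "i \<in> infwords N" "z \<in> nbhd \<epsilon>" shows "cmod (TC i n z) \<le> M * c ^ n"
proof -
  have k: "i n < N" and w: "rev_prefix i n \<in> words N"
    using assms infwords_less rev_prefix_words by auto
  have psz: "cmod (pre_schwarzian (Fs (i n)) (FW (rev_prefix i n) z)) \<le> M"
    using psz_le[OF k FW_into[OF w assms(2)]] .
  then have "0 \<le> M" using norm_ge_zero order_trans by blast
  then show ?thesis
    unfolding TC_def norm_mult using psz deriv_FW[OF w assms(2)]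
    by (intro mult_mono) (auto simp: rev_prefix_def)
qed

lemma summable_bound: "summable (\<lambda>n. M * c ^ n)"
  using c by (intro summable_mult summable_geometric) auto

lemma summable_TC:
  assumes "i \<in> infwords N" "z \<in> nbhd \<epsilon>" shows "summable (\<lambda>n. TC i n z)"
  by (rule summable_comparison_test'[OF summable_bound norm_TC_le[OF assms]])

lemma norm_HC_le:
  assumes "i \<in> infwords N" "z \<in> nbhd \<epsilon>" shows "cmod (HC i z) \<le> (\<Sum>n. M * c ^ n)"
  unfolding HC_def by (rule norm_suminf_le[OF norm_TC_le[OF assms] summable_bound])

text \<open>The geometric majorant gives uniform convergence, and a uniform limit of holomorphic
  partial sums is holomorphic.\<close>

lemma holomorphic_HC:
  assumes "i \<in> infwords N" shows "HC i holomorphic_on nbhd \<epsilon>"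
proof -
  obtain g g' where g: "\<forall>z\<in>nbhd \<epsilon>. (\<lambda>n. TC i n z) sums g z \<and> (\<lambda>n. deriv (TC i n) z) sums g' z
      \<and> (g has_field_derivative g' z) (at z)"
  proof (rule series_and_derivative_comparison[OF open_nbhd summable_bound
        holomorphic_derivI[OF holomorphic_TC[OF assms] open_nbhd]])
    show "\<forall>\<^sub>F n in sequentially. \<forall>z\<in>nbhd \<epsilon>. cmod (TC i n z) \<le> M * c ^ n"
      using norm_TC_le[OF assms] by simp
  qed (use that in auto)
  then have "g holomorphic_on nbhd \<epsilon>"
    using holomorphic_on_open open_nbhd by blast
  then show ?thesis
    by (rule holomorphic_transform) (use g in \<open>auto simp: HC_def sums_iff\<close>)
qed

lemma pre_schwarzian_of_real:
  assumes k: "k < N" and x: "complex_of_real x \<in> nbhd \<epsilon>"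
  shows "pre_schwarzian (Fs k) (of_real x) = of_real (deriv (deriv (\<Phi> ! k)) x / deriv (\<Phi> ! k) x)"
proof -
  have d: "deriv (Fs k) (of_real y) = of_real (deriv (\<Phi> ! k) y)" if "complex_of_real y \<in> nbhd \<epsilon>" for y
    by (rule deriv_commute_of_real[OF hol[OF k] open_nbhd ext[OF k] that])
  have "deriv (deriv (Fs k)) (of_real x) = of_real (deriv (deriv (\<Phi> ! k)) x)"
    by (rule deriv_commute_of_real[OF holomorphic_deriv[OF hol[OF k] open_nbhd] open_nbhd d x])
  then show ?thesis
    by (simp add: pre_schwarzian_def d[OF x])
qed

lemma HC_of_real:
  assumes "i \<in> infwords N" "complex_of_real x \<in> nbhd \<epsilon>"
  shows "HC i (of_real x) = of_real (H \<Phi> i x)"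
proof -
  define T where "T n = deriv (deriv (\<Phi> ! i n)) (word_map \<Phi> (rev_prefix i n) x)
                   / deriv (\<Phi> ! i n) (word_map \<Phi> (rev_prefix i n) x)
                 * deriv (word_map \<Phi> (rev_prefix i n)) x" for n
  have T: "TC i n (of_real x) = of_real (T n)" for n
  proof -
    have k: "i n < N" and w: "rev_prefix i n \<in> words N"
      using assms infwords_less rev_prefix_words by auto
    have "complex_of_real (word_map \<Phi> (rev_prefix i n) x) \<in> nbhd \<epsilon>"
      using FW_into[OF w assms(2)] FW_ext[OF w assms(2)] by simp
    then show ?thesis
      using pre_schwarzian_of_real[OF k] FW_ext[OF w assms(2)]
        deriv_commute_of_real[OF FW_hol[OF w] open_nbhd FW_ext[OF w] assms(2)]
      by (simp add: TC_def T_def)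
  qed
  have "summable T"
    using summable_TC[OF assms] by (simp add: T)
  then show ?thesis
    unfolding HC_def H_def T_def[symmetric] by (simp add: T suminf_of_real)
qed

text \<open>Every term after the first contains \<open>Fs (i 0)\<close> as innermost map; by the
  chain rule its derivative factors out, leaving the series of the shifted word at the image
  point.\<close>

lemma HC_shift:
  assumes i: "i \<in> infwords N" and z: "z \<in> nbhd \<epsilon>"
  shows "HC i z = pre_schwarzian (Fs (i 0)) z + HC (\<lambda>k. i (Suc k)) (Fs (i 0) z) * deriv (Fs (i 0)) z"
proof -
  let ?s = "\<lambda>k. i (Suc k)"
  have s: "?s \<in> infwords N" using i by (auto simp: infwords_def)
  have k: "i 0 < N" using infwords_less[OF i] .
  have "TC i (Suc n) z = TC ?s n (Fs (i 0) z) * deriv (Fs (i 0)) z" for n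
    using deriv_FW_compose[OF rev_prefix_words[OF s], of "[i 0]" z n] k z
    by (simp add: TC_def rev_prefix_Suc_shift FW_append)
  moreover have "TC i 0 z = pre_schwarzian (Fs (i 0)) z"
    by (simp add: TC_def rev_prefix_def id_def)
  moreover have "HC i z = TC i 0 z + (\<Sum>n. TC i (Suc n) z)"
    unfolding HC_def using suminf_split_head[OF summable_TC[OF i z]] by simp
  ultimately show ?thesis
    using suminf_mult2[OF summable_TC[OF s into[OF k z]]] by (simp add: HC_def)
qed

text \<open>Iterates the one-letter shift; the rule for pre-Schwarzians of compositions merges the
  first \<open>n\<close> terms into a single one.\<close>

lemma HC_shift_n:
  assumes i: "i \<in> infwords N" and z: "z \<in> nbhd \<epsilon>"
  shows "HC i z = pre_schwarzian (FW (rev_prefix i n)) z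
      + HC (\<lambda>k. i (n + k)) (FW (rev_prefix i n) z) * deriv (FW (rev_prefix i n)) z"
proof (induction n)
  case 0
  then show ?case by (simp add: rev_prefix_def pre_schwarzian_def id_def)
next
  case (Suc n)
  let ?F = "FW (rev_prefix i n)"
  have w: "rev_prefix i n \<in> words N" and k: "i n < N"
    using i infwords_less rev_prefix_words by auto
  have s: "(\<lambda>k. i (n + k)) \<in> infwords N" using i by (auto simp: infwords_def)
  have Fz: "?F z \<in> nbhd \<epsilon>" using FW_into[OF w z] .
  have "HC (\<lambda>k. i (n + k)) (?F z) = pre_schwarzian (Fs (i n)) (?F z)
      + HC (\<lambda>k. i (Suc n + k)) (Fs (i n) (?F z)) * deriv (Fs (i n)) (?F z)"
    using HC_shift[OF s Fz] by simp
  moreover have "pre_schwarzian (\<lambda>w. Fs (i n) (?F w)) z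
      = pre_schwarzian ?F z + pre_schwarzian (Fs (i n)) (?F z) * deriv ?F z"
    using deriv_FW[OF w z] deriv_nz[OF k Fz]
    by (intro pre_schwarzian_compose[OF FW_hol[OF w] hol[OF k] open_nbhd FW_into[OF w] z]) auto
  moreover have "deriv (\<lambda>w. Fs (i n) (?F w)) z = deriv (Fs (i n)) (?F z) * deriv ?F z"
    using deriv_FW_compose[of "[i n]", OF _ w z] k by simp
  ultimately show ?case
    using Suc by (simp add: rev_prefix_Suc algebra_simps)
qed

lemma periodic_infwords: "w \<in> words N \<Longrightarrow> w \<noteq> [] \<Longrightarrow> periodic w \<in> infwords N"
  by (auto simp: periodic_def words_def infwords_def subset_iff)

text \<open>Shifting the periodic word by one period leaves it unchanged, so the shift equation
  becomes the functional equation. The word is reversed because its first letter is applied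
  first.\<close>

lemma log_cocycle_periodic:
  assumes "w \<in> words N" "w \<noteq> []"
  shows "log_cocycle (FW (rev w)) (HC (periodic w))"
proof -
  have "map (periodic w) [0..<length w] = w"
    by (rule nth_equalityI) (auto simp: periodic_def)
  then have "rev_prefix (periodic w) (length w) = rev w"
    by (simp add: rev_prefix_def)
  moreover have "(\<lambda>k. periodic w (length w + k)) = periodic w"
    by (auto simp: periodic_def)
  ultimately show ?thesis
    using HC_shift_n[OF periodic_infwords[OF assms] seg_nbhd, of _ "length w"]
    by (simp add: log_cocycle_def)
qed

text \<open>If one bounded \<open>q\<close> solves the equation of every map, the partial sums
  telescope along any word, with a remainder of size at most \<open>b * c ^ n\<close>. Hence the sum
  does not depend on the word.\<close>

lemma HC_eq_if_log_cocycle: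
  assumes i: "i \<in> infwords N" and "bounded (q ` unit_seg)"
    and q: "\<And>k. k < N \<Longrightarrow> log_cocycle (Fs k) q" and z: "z \<in> unit_seg"
  shows "HC i z = q z"
proof -
  obtain b where b: "\<And>z. z \<in> unit_seg \<Longrightarrow> cmod (q z) \<le> b"
    using assms(2) by (auto simp: bounded_iff)
  have partial: "(\<Sum>m<n. TC i m z) = q z - q (FW (rev_prefix i n) z) * deriv (FW (rev_prefix i n)) z" for n
  proof (induction n)
    case 0
    then show ?case by (simp add: rev_prefix_def id_def)
  next
    case (Suc n)
    let ?F = "FW (rev_prefix i n)"
    have w: "rev_prefix i n \<in> words N" and k: "i n < N"
      using i infwords_less rev_prefix_words by auto
    have "q (?F z) = pre_schwarzian (Fs (i n)) (?F z) + q (Fs (i n) (?F z)) * deriv (Fs (i n)) (?F z)"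
      using q[OF k] FW_unit_seg[OF w z] by (simp add: log_cocycle_def)
    moreover have "deriv (\<lambda>w. Fs (i n) (?F w)) z = deriv (Fs (i n)) (?F z) * deriv ?F z"
      using deriv_FW_compose[of "[i n]", OF _ w seg_nbhd[OF z]] k by simp
    ultimately show ?case
      using Suc by (simp add: rev_prefix_Suc TC_def algebra_simps)
  qed
  have "(\<lambda>n. q (FW (rev_prefix i n) z) * deriv (FW (rev_prefix i n)) z) \<longlonglongrightarrow> 0"
  proof (rule Lim_null_comparison)
    have "cmod (q (FW (rev_prefix i n) z)) * cmod (deriv (FW (rev_prefix i n)) z) \<le> b * c ^ n" for n
      using b[OF FW_unit_seg[OF rev_prefix_words[OF i] z], of n]
        deriv_FW[OF rev_prefix_words[OF i] seg_nbhd[OF z], of n] b[OF z]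
      by (intro mult_mono) (auto simp: rev_prefix_def intro: order_trans[OF norm_ge_zero])
    then show "\<forall>\<^sub>F n in sequentially. cmod (q (FW (rev_prefix i n) z) * deriv (FW (rev_prefix i n)) z) \<le> b * c ^ n"
      by (simp add: norm_mult)
    show "(\<lambda>n. b * c ^ n) \<longlonglongrightarrow> 0"
      using c by (intro tendsto_mult_right_zero LIMSEQ_realpow_zero)
  qed
  then have "(\<lambda>n. \<Sum>m<n. TC i m z) \<longlonglongrightarrow> q z - 0"
    unfolding partial by (intro tendsto_diff tendsto_const)
  then show ?thesis
    by (simp add: HC_def sums_def sums_unique[symmetric])
qed

end

section \<open>Conjugacy to self-similar systems\<close>

lemma log_cocycle_cong:
  assumes "log_cocycle F q" "F ` unit_seg \<subseteq> unit_seg" "\<And>z. z \<in> unit_seg \<Longrightarrow> q z = q' z"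
  shows "log_cocycle F q'"
  unfolding log_cocycle_def
proof
  fix z assume z: "z \<in> unit_seg"
  then have "F z \<in> unit_seg" using assms(2) by blast
  then show "q' z = pre_schwarzian F z + q' (F z) * deriv F z"
    using assms(1) z unfolding log_cocycle_def by (simp flip: assms(3))
qed

context complex_ifs
begin

text \<open>The multiplier is a derivative of \<open>FW w\<close> at a point of the segment: real
  because \<open>FW w\<close> extends a real map, nonzero and of modulus below 1 by contraction.
  Real parts of the complex relation give the real one.\<close>

lemma log_cocycle_imp_similarity:
  assumes G: "linearizer \<epsilon> h G" and w: "w \<in> words N" "w \<noteq> []" and "log_cocycle (FW w) h"
  defines "g \<equiv> \<lambda>x. Re (G (of_real x))"
  shows "\<exists>a t. a \<in> {-1<..<1} - {0} \<and> (\<forall>x\<in>{0..1}. g (word_map \<Phi> w x) = a * g x + t)"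
proof -
  obtain p t where p: "p \<in> unit_seg" and
    eq: "\<And>z. z \<in> unit_seg \<Longrightarrow> G (FW w z) = deriv (FW w) p * G z + t"
    using linearizer_conjugates[OF G eps seg_contraction_FW[OF w] assms(4)] by blast
  obtain x where x: "p = of_real x" "x \<in> {0..1}"
    using p by (auto simp: unit_seg_def)
  define a where "a = deriv (word_map \<Phi> w) x"
  have a: "deriv (FW w) p = of_real a"
    unfolding x(1) a_def using seg_nbhd[OF p] x(1)
    by (intro deriv_commute_of_real[OF FW_hol[OF w(1)] open_nbhd FW_ext[OF w(1)]]) auto
  have "seg_contraction c (FW w)"
    by (rule seg_contraction_FW[OF w])
  then have "deriv (FW w) p \<noteq> 0" "cmod (deriv (FW w) p) < 1"
    using p by (auto simp: seg_contraction_def)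
  then have "a \<in> {-1<..<1} - {0}"
    by (auto simp: a)
  moreover have "g (word_map \<Phi> w y) = a * g y + Re t" if y: "y \<in> {0..1}" for y
  proof -
    have "complex_of_real y \<in> unit_seg" using y by (auto simp: unit_seg_def)
    then have "G (of_real (word_map \<Phi> w y)) = of_real a * G (of_real y) + t"
      using eq[of "of_real y"] FW_ext[OF w(1)] seg_nbhd a by simp
    then show ?thesis
      by (simp add: g_def)
  qed
  ultimately show ?thesis by blast
qed

lemma linearizer_real:
  assumes "linearizer \<epsilon> h G" "x \<in> {0..1}"
  shows "G (of_real x) = of_real (Re (G (of_real x)))"
proof -
  have "G (of_real x) \<in> \<real>"
    using assms by (auto simp: linearizer_def unit_seg_def)
  then show ?thesis by (simp add: complex_is_Real_iff complex_eq_iff)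
qed

lemma linearizer_real_analytic:
  assumes G: "linearizer \<epsilon> h G"
  defines "g \<equiv> \<lambda>x. Re (G (of_real x))"
  shows "real_analytic_on g {0..1}" "inj_on g {0..1}"
proof -
  have "G analytic_on of_real ` {0..1}"
    using G eps analytic_on_unit_seg by (auto simp: linearizer_def simp flip: unit_seg_def)
  then show "real_analytic_on g {0..1}"
    using linearizer_real[OF G] unfolding real_analytic_on_def g_def by blast
  obtain \<delta> where \<delta>: "\<delta> > 0" "inj_on G (nbhd \<delta>)"
    using linearizer_inj[OF G eps] by blast
  show "inj_on g {0..1}"
  proof (rule inj_onI)
    fix x y assume xy: "x \<in> {0..1}" "y \<in> {0..1}" "g x = g y"
    then have "G (of_real x) = G (of_real y)"
      using linearizer_real[OF G] by (metis g_def)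
    moreover have "complex_of_real x \<in> nbhd \<delta>" "complex_of_real y \<in> nbhd \<delta>"
      using xy unit_seg_subset_nbhd[OF \<delta>(1)] by (auto simp: unit_seg_def)
    ultimately show "x = y"
      using \<delta>(2) by (metis inj_onD of_real_eq_iff)
  qed
qed

text \<open>The extension is \<open>G \<circ> Fs k \<circ> K\<close> with \<open>K\<close> the
  holomorphic inverse of \<open>G\<close>, defined on the image of \<open>nbhd \<delta>\<close>,
  which is open by the open mapping theorem and contains the interval.\<close>

lemma linearizer_conjugate_analytic:
  assumes G: "linearizer \<epsilon> h G" and k: "k < N"
  defines "g \<equiv> \<lambda>x. Re (G (of_real x))"
  shows "real_analytic_on (\<lambda>y. g ((\<Phi> ! k) (the_inv_into {0..1} g y))) (g ` {0..1})"
proof -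
  obtain \<delta> where \<delta>: "\<delta> > 0" "nbhd \<delta> \<subseteq> nbhd \<epsilon>" "inj_on G (nbhd \<delta>)"
    using linearizer_inj[OF G eps] by blast
  have Gh: "G holomorphic_on nbhd \<epsilon>"
    using G by (simp add: linearizer_def)
  then have Gd: "G holomorphic_on nbhd \<delta>"
    using \<delta>(2) holomorphic_on_subset by blast
  obtain K where K: "K holomorphic_on G ` nbhd \<delta>" "\<And>z. z \<in> nbhd \<delta> \<Longrightarrow> K (G z) = z"
    using holomorphic_has_inverse[OF Gd open_nbhd \<delta>(3)] by metis
  have inj: "inj_on g {0..1}"
    unfolding g_def by (rule linearizer_real_analytic(2)[OF G])
  have "(Fs k \<circ> K) holomorphic_on G ` nbhd \<delta>"
    using K(2) \<delta>(2) by (intro holomorphic_on_compose_gen[OF K(1) hol[OF k]]) auto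
  then have "(G \<circ> (Fs k \<circ> K)) holomorphic_on G ` nbhd \<delta>"
    using K(2) \<delta>(2) into[OF k] by (intro holomorphic_on_compose_gen[OF _ Gh]) auto
  moreover have "open (G ` nbhd \<delta>)"
    using open_mapping_thm3[OF Gd open_nbhd \<delta>(3)] .
  moreover have seg_d: "complex_of_real x \<in> nbhd \<delta>" if "x \<in> {0..1}" for x
    using that unit_seg_subset_nbhd[OF \<delta>(1)] by (auto simp: unit_seg_def)
  have gG: "complex_of_real (g x) = G (of_real x)" if "x \<in> {0..1}" for x
    using linearizer_real[OF G that] by (simp add: g_def)
  then have "of_real ` g ` {0..1} \<subseteq> G ` nbhd \<delta>"
    using seg_d by auto
  ultimately have "(G \<circ> (Fs k \<circ> K)) analytic_on of_real ` g ` {0..1}"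
    by (meson analytic_on_holomorphic)
  moreover have "(G \<circ> (Fs k \<circ> K)) (of_real y) = of_real (g ((\<Phi> ! k) (the_inv_into {0..1} g y)))"
    if "y \<in> g ` {0..1}" for y
  proof -
    obtain x where x: "x \<in> {0..1}" "y = g x" using \<open>y \<in> g ` {0..1}\<close> by blast
    have "K (of_real y) = of_real x"
      using gG[OF x(1)] K(2)[OF seg_d[OF x(1)]] x(2) by simp
    moreover have "Fs k (of_real x) = of_real ((\<Phi> ! k) x)"
      using ext[OF k] seg_d[OF x(1)] \<delta>(2) by blast
    ultimately show ?thesis
      using gG[OF seg[OF k x(1)]] the_inv_into_f_f[OF inj x(1)] x(2) by simp
  qed
  ultimately show ?thesis
    unfolding real_analytic_on_def by blast
qed

lemma HC_real: "i \<in> infwords N \<Longrightarrow> z \<in> unit_seg \<Longrightarrow> HC i z \<in> \<real>"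
  using HC_of_real seg_nbhd by (auto simp: unit_seg_def)

lemma HC_eq_iff:
  assumes "i \<in> infwords N" "j \<in> infwords N"
  shows "(\<forall>x\<in>{0..1}. H \<Phi> i x = H \<Phi> j x) \<longleftrightarrow> (\<forall>z\<in>unit_seg. HC i z = HC j z)"
  using HC_of_real[OF assms(1)] HC_of_real[OF assms(2)] seg_nbhd by (auto simp: unit_seg_def)

lemma bounded_HC: "i \<in> infwords N \<Longrightarrow> bounded (HC i ` unit_seg)"
  unfolding bounded_iff using norm_HC_le seg_nbhd by blast

text \<open>The analytic extension of \<open>g\<close> inherits injectivity and the affine relations
  on the segment, so the complex results apply. A single \<open>q\<close> serves all of
  \<open>W\<close> because one \<open>g\<close> linearises all its words.\<close>

lemma similarity_imp_log_cocycle: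
  assumes g: "real_analytic_on g {0..1}" "inj_on g {0..1}" and W: "W \<noteq> {}"
    and w: "\<And>w. w \<in> W \<Longrightarrow> w \<in> words N \<and> w \<noteq> []"
    and sim: "\<And>w. w \<in> W \<Longrightarrow> \<exists>a t. a \<noteq> 0 \<and> (\<forall>x\<in>{0..1}. g (word_map \<Phi> w x) = a * g x + t)"
  obtains q where "bounded (q ` unit_seg)" "\<And>w. w \<in> W \<Longrightarrow> log_cocycle (FW w) q"
proof -
  obtain G where G: "G analytic_on unit_seg" "\<And>x. x \<in> {0..1} \<Longrightarrow> G (of_real x) = of_real (g x)"
    using g(1) by (auto simp: real_analytic_on_def unit_seg_def)
  have "inj_on G unit_seg"
    using g(2) by (auto simp: inj_on_def unit_seg_def G(2))
  moreover have "semiconj G (FW w)" if wW: "w \<in> W" for w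
  proof -
    obtain a t where a: "a \<noteq> 0" "\<And>x. x \<in> {0..1} \<Longrightarrow> g (word_map \<Phi> w x) = a * g x + t"
      using sim[OF wW] by blast
    have ww: "w \<in> words N" using w[OF wW] by blast
    have "G (FW w z) = of_real a * G z + of_real t" if z: "z \<in> unit_seg" for z
    proof -
      obtain x where x: "z = of_real x" "x \<in> {0..1}"
        using z by (auto simp: unit_seg_def)
      show ?thesis
        using FW_ext[OF ww] seg_nbhd[OF z] G(2)[OF x(2)]
          G(2)[OF word_map_seg[OF ww x(2)]] a(2)[OF x(2)] x(1)
        by simp
    qed
    then show ?thesis
      unfolding semiconj_def using a(1) by (metis of_real_eq_0_iff)
  qed
  moreover have "FW ` W \<noteq> {}" "\<And>F. F \<in> FW ` W \<Longrightarrow> seg_contraction c F"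
    using seg_contraction_FW w W by auto
  ultimately obtain q where q: "continuous_on unit_seg q" "\<And>F. F \<in> FW ` W \<Longrightarrow> log_cocycle F q"
    using semiconj_imp_log_cocycle[of "FW ` W" c G] G(1) by (metis (no_types, lifting) imageE)
  have "bounded (q ` unit_seg)"
    by (rule compact_imp_bounded[OF compact_continuous_image[OF q(1) compact_unit_seg]])
  then show thesis
    using q(2) by (intro that) auto
qed

end

lemma conjugated_to_self_similar_iff_similarity:
  assumes "\<forall>f\<in>set \<Phi>. f ` {0..1} \<subseteq> {0..1}"
  shows "conjugated_to_self_similar \<Phi> \<longleftrightarrow>
     (\<exists>g. real_analytic_on g {0..1} \<and> inj_on g {0..1} \<and>
        (\<forall>f\<in>set \<Phi>. \<exists>a t. a \<in> {-1<..<1} - {0} \<and> (\<forall>x\<in>{0..1}. g (f x) = a * g x + t)))"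
proof -
  have *: "(\<forall>x\<in>{0..1}. a * g x + t \<in> g ` {0..1} \<and> f x = the_inv_into {0..1} g (a * g x + t)) \<longleftrightarrow>
      (\<forall>x\<in>{0..1}. g (f x) = a * g x + t)"
    if "inj_on g {0..1}" "f \<in> set \<Phi>" for g f a t
  proof (intro ball_cong refl iffI conjI)
    fix x :: real assume x: "x \<in> {0..1}"
    have fx: "f x \<in> {0..1}" using assms that(2) x by blast
    { assume "a * g x + t \<in> g ` {0..1} \<and> f x = the_inv_into {0..1} g (a * g x + t)"
      then show "g (f x) = a * g x + t"
        using f_the_inv_into_f[OF that(1)] by metis }
    { assume e: "g (f x) = a * g x + t"
      show "a * g x + t \<in> g ` {0..1}"
        using fx e by (metis imageI)
      show "f x = the_inv_into {0..1} g (a * g x + t)"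
        using the_inv_into_f_f[OF that(1) fx] e by simp }
  qed
  show ?thesis
    unfolding conjugated_to_self_similar_iff[OF assms]
    by (intro ex_cong1 conj_cong refl ball_cong[where A = "set \<Phi>"]) (simp only: *)
qed

text \<open>The closed neighbourhood is compact and lies in the domain of analyticity. The
  derivative attains its maximal modulus there, so the pointwise bound by 1 improves to a constant
  \<open>c < 1\<close>, and the pre-Schwarzian is bounded.\<close>

lemma analytic_contraction_extension:
  assumes "f \<in> analytic_contractions \<epsilon>" "\<epsilon> > 0"
  obtains F c M where "0 \<le> c" "c < 1" "F holomorphic_on nbhd \<epsilon>" "F ` nbhd \<epsilon> \<subseteq> nbhd \<epsilon>"
    "f ` {0..1} \<subseteq> {0..1}"
    "\<And>x. complex_of_real x \<in> nbhd \<epsilon> \<Longrightarrow> F (of_real x) = of_real (f x)"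
    "\<And>z. z \<in> nbhd \<epsilon> \<Longrightarrow> deriv F z \<noteq> 0 \<and> cmod (deriv F z) \<le> c \<and> cmod (pre_schwarzian F z) \<le> M"
proof -
  obtain F where F: "F analytic_on nbhd (2 * \<epsilon>)"
    "\<And>x. complex_of_real x \<in> nbhd (2 * \<epsilon>) \<Longrightarrow> F (of_real x) = of_real (f x)"
    "f ` {0..1} \<subseteq> {0..1}" "F ` closure (nbhd \<epsilon>) \<subseteq> nbhd \<epsilon>"
    "\<And>z. z \<in> closure (nbhd \<epsilon>) \<Longrightarrow> deriv F z \<noteq> 0 \<and> cmod (deriv F z) < 1"
    using assms(1) by (auto simp: analytic_contractions_def)
  let ?K = "closure (nbhd \<epsilon>)"
  have K: "?K \<subseteq> nbhd (2 * \<epsilon>)" "compact ?K" "nbhd \<epsilon> \<subseteq> ?K"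
    using closure_nbhd_subset[OF assms(2)] compact_closure_nbhd closure_subset by auto
  have "0 \<in> unit_seg" by (simp add: unit_seg_eq)
  then have "?K \<noteq> {}"
    using K(3) unit_seg_subset_nbhd[OF assms(2)] by blast
  have FK: "F analytic_on ?K"
    using F(1) K(1) analytic_on_subset by blast
  have "continuous_on ?K (deriv F)"
    using FK by (intro analytic_imp_holomorphic[THEN holomorphic_on_imp_continuous_on] analytic_deriv)
  then have "continuous_on ?K (\<lambda>z. cmod (deriv F z))"
    by (rule continuous_on_norm)
  then obtain z0 where z0: "z0 \<in> ?K" "\<And>z. z \<in> ?K \<Longrightarrow> cmod (deriv F z) \<le> cmod (deriv F z0)"
    using continuous_attains_sup[OF K(2) \<open>?K \<noteq> {}\<close>] by blast
  have "pre_schwarzian F analytic_on ?K"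
    unfolding pre_schwarzian_def using FK F(5) by (intro analytic_intros) auto
  then have "continuous_on ?K (pre_schwarzian F)"
    by (rule analytic_imp_holomorphic[THEN holomorphic_on_imp_continuous_on])
  then have "bounded (pre_schwarzian F ` ?K)"
    using K(2) compact_continuous_image compact_imp_bounded by blast
  then obtain M where M: "\<And>z. z \<in> ?K \<Longrightarrow> cmod (pre_schwarzian F z) \<le> M"
    by (auto simp: bounded_iff)
  show thesis
  proof (rule that[of "cmod (deriv F z0)" F M])
    show "F holomorphic_on nbhd \<epsilon>"
      using FK K(3) analytic_imp_holomorphic holomorphic_on_subset by blast
    show "F ` nbhd \<epsilon> \<subseteq> nbhd \<epsilon>"
      using F(4) K(3) by blast
    show "F (of_real x) = of_real (f x)" if "complex_of_real x \<in> nbhd \<epsilon>" for x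
      using F(2) K that by blast
    show "deriv F z \<noteq> 0 \<and> cmod (deriv F z) \<le> cmod (deriv F z0) \<and> cmod (pre_schwarzian F z) \<le> M"
      if "z \<in> nbhd \<epsilon>" for z
      using that F(5) z0 M K(3) by blast
  qed (use z0(1) F(3,5) in auto)
qed

lemma IFS_complex_ifs:
  assumes "\<epsilon> > 0" "\<Phi> \<in> IFS \<epsilon> N"
  obtains c M Fs where "complex_ifs \<epsilon> c M N \<Phi> Fs"
proof -
  have "\<exists>F c M. 0 \<le> c \<and> c < 1 \<and> F holomorphic_on nbhd \<epsilon> \<and> F ` nbhd \<epsilon> \<subseteq> nbhd \<epsilon> \<and>
    (\<Phi> ! k) ` {0..1} \<subseteq> {0..1} \<and>
    (\<forall>x. complex_of_real x \<in> nbhd \<epsilon> \<longrightarrow> F (of_real x) = of_real ((\<Phi> ! k) x)) \<and>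
    (\<forall>z\<in>nbhd \<epsilon>. deriv F z \<noteq> 0 \<and> cmod (deriv F z) \<le> c \<and> cmod (pre_schwarzian F z) \<le> M)" if "k < N" for k
  proof -
    have "\<Phi> ! k \<in> analytic_contractions \<epsilon>"
      using assms(2) that by (auto simp: IFS_def)
    then show ?thesis
      by (rule analytic_contraction_extension[OF _ assms(1)]) blast
  qed
  then obtain Fs cs Ms where *: "\<And>k. k < N \<Longrightarrow> 0 \<le> cs k \<and> cs k < (1::real) \<and> Fs k holomorphic_on nbhd \<epsilon> \<and>
    Fs k ` nbhd \<epsilon> \<subseteq> nbhd \<epsilon> \<and> (\<Phi> ! k) ` {0..1} \<subseteq> {0..1} \<and>
    (\<forall>x. complex_of_real x \<in> nbhd \<epsilon> \<longrightarrow> Fs k (of_real x) = of_real ((\<Phi> ! k) x)) \<and>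
    (\<forall>z\<in>nbhd \<epsilon>. deriv (Fs k) z \<noteq> 0 \<and> cmod (deriv (Fs k) z) \<le> cs k \<and> cmod (pre_schwarzian (Fs k) z) \<le> Ms k)"
    by metis
  \<comment> \<open>Finitely many constants are replaced by their maxima; the inserted 0 keeps the
    sets non-empty when \<open>N = 0\<close> and ensures \<open>0 \<le> c\<close>.\<close>
  define c where "c = Max (insert 0 (cs ` {..<N}))"
  define M where "M = Max (insert 0 (Ms ` {..<N}))"
  have le: "cs k \<le> c" "Ms k \<le> M" if "k < N" for k
    using that by (auto simp: c_def M_def)
  have "complex_ifs \<epsilon> c M N \<Phi> Fs"
  proof
    show "0 \<le> c" "c < 1"
      using * by (auto simp: c_def)
    fix k assume k: "k < N"
    show "(\<Phi> ! k) x \<in> {0..1}" if "x \<in> {0..1}" for x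
      using *[OF k] that by blast
    fix z assume z: "z \<in> nbhd \<epsilon>"
    show "cmod (deriv (Fs k) z) \<le> c" "cmod (pre_schwarzian (Fs k) z) \<le> M"
      using *[OF k] le[OF k] z by (meson order_trans)+
  qed (use * assms(1) in blast)+
  then show thesis by (rule that)
qed

theorem theorem1p12:
  fixes \<epsilon> :: real and N :: nat and \<Phi> :: "(real \<Rightarrow> real) list"
  assumes "\<epsilon> > 0" and "N \<ge> 1" and "\<Phi> \<in> IFS \<epsilon> N"
  shows "(\<exists>g \<Psi>. conjugated_via g \<Phi> \<Psi> \<and> analytic_IFS_on (g ` {0..1}) \<Psi> \<and>
            (\<exists>h\<in>set \<Psi>. similarity_on (g ` {0..1}) h)) \<and>
         (\<not> is_singleton (attractor \<Phi>) \<longrightarrow>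
            (conjugated_to_self_similar \<Phi> \<longleftrightarrow>
               (\<forall>i\<in>infwords N. \<forall>j\<in>infwords N. \<forall>x\<in>{0..1}. H \<Phi> i x = H \<Phi> j x)) \<and>
            (sub_conjugated_to_self_similar \<Phi> \<longleftrightarrow>
               (\<exists>i\<in>words N. \<exists>j\<in>words N. i \<noteq> j \<and> length i = length j \<and>
                  (\<forall>x\<in>{0..1}. H \<Phi> (periodic i) x = H \<Phi> (periodic j) x))))"
proof -
  obtain c M Fs where "complex_ifs \<epsilon> c M N \<Phi> Fs"
    using IFS_complex_ifs[OF assms(1,3)] .
  then interpret complex_ifs \<epsilon> c M N \<Phi> Fs .
  have len: "length \<Phi> = N"
    using assms(3) by (simp add: IFS_def)
  have set_\<Phi>: "set \<Phi> = {\<Phi> ! k |k. k < N}"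
    using len by (auto simp: set_conv_nth)
  have zero: "periodic [0] \<in> infwords N" and letter: "\<And>k. k < N \<Longrightarrow> [k] \<in> words N"
    using assms(2) by (auto intro!: periodic_infwords)
  \<comment> \<open>The series of the constant word 000... solves the equation of the map with index
    0, so \<open>G\<close> linearises that map, and every other map whose equation the series
    solves.\<close>
  obtain G where G: "linearizer \<epsilon> (HC (periodic [0])) G"
    using linearizer_exists[OF holomorphic_HC[OF zero] eps HC_real[OF zero]] by blast
  define g where "g x = Re (G (of_real x))" for x :: real
  have g: "real_analytic_on g {0..1}" "inj_on g {0..1}"
    unfolding g_def[abs_def] by (rule linearizer_real_analytic[OF G])+
  have sim: "\<exists>a t. a \<in> {-1<..<1} - {0} \<and> (\<forall>x\<in>{0..1}. g ((\<Phi> ! k) x) = a * g x + t)"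
    if "k < N" "log_cocycle (Fs k) (HC (periodic [0]))" for k
    using log_cocycle_imp_similarity[OF G letter[OF that(1)]] that(2) by (simp add: g_def)

  \<comment> \<open>A conjugate system with one similarity\<close>
  have part1: "\<exists>g \<Psi>. conjugated_via g \<Phi> \<Psi> \<and> analytic_IFS_on (g ` {0..1}) \<Psi> \<and>
      (\<exists>h\<in>set \<Psi>. similarity_on (g ` {0..1}) h)"
  proof (intro exI conjI)
    let ?\<Psi> = "map (\<lambda>f y. g (f (the_inv_into {0..1} g y))) \<Phi>"
    show "conjugated_via g \<Phi> ?\<Psi>"
      using g by (simp add: conjugated_via_def list_all2_conv_all_nth)
    show "analytic_IFS_on (g ` {0..1}) ?\<Psi>"
      using linearizer_conjugate_analytic[OF G] unfolding analytic_IFS_on_def set_\<Phi> set_map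
      by (auto simp: g_def[abs_def])
    have "log_cocycle (Fs 0) (HC (periodic [0]))"
      using log_cocycle_periodic[of "[0]"] assms(2) by simp
    then obtain a t where at: "a \<in> {-1<..<1} - {0}" "\<And>x. x \<in> {0..1} \<Longrightarrow> g ((\<Phi> ! 0) x) = a * g x + t"
      using sim[of 0] assms(2) by auto
    have "similarity_on (g ` {0..1}) (\<lambda>y. g ((\<Phi> ! 0) (the_inv_into {0..1} g y)))"
      unfolding similarity_on_def
      using at by (intro exI[of _ a] exI[of _ t]) (auto simp: the_inv_into_f_f[OF g(2)])
    moreover have "\<Phi> ! 0 \<in> set \<Phi>"
      using len assms(2) by auto
    ultimately show "\<exists>h\<in>set ?\<Psi>. similarity_on (g ` {0..1}) h"
      by auto
  qed

  \<comment> \<open>Self-similarity of the whole system\<close>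
  have part2: "conjugated_to_self_similar \<Phi> \<longleftrightarrow>
      (\<forall>i\<in>infwords N. \<forall>j\<in>infwords N. \<forall>x\<in>{0..1}. H \<Phi> i x = H \<Phi> j x)"
  proof -
    have into: "\<forall>f\<in>set \<Phi>. f ` {0..1} \<subseteq> {0..1}"
      using seg unfolding set_\<Phi> by blast
    show ?thesis
      unfolding conjugated_to_self_similar_iff_similarity[OF into]
    proof
      assume "\<exists>g. real_analytic_on g {0..1} \<and> inj_on g {0..1} \<and>
        (\<forall>f\<in>set \<Phi>. \<exists>a t. a \<in> {-1<..<1} - {0} \<and> (\<forall>x\<in>{0..1}. g (f x) = a * g x + t))"
      then obtain g where g: "real_analytic_on g {0..1}" "inj_on g {0..1}"
        "\<And>f. f \<in> set \<Phi> \<Longrightarrow> \<exists>a t. a \<in> {-1<..<1} - {0} \<and> (\<forall>x\<in>{0..1}. g (f x) = a * g x + t)"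
        by blast
      \<comment> \<open>The maps of the system are the compositions along one-letter words.\<close>
      obtain q where q: "bounded (q ` unit_seg)" "\<And>w. w \<in> {[k] |k. k < N} \<Longrightarrow> log_cocycle (FW w) q"
      proof (rule similarity_imp_log_cocycle[OF g(1,2), of "{[k] |k. k < N}"])
        show "{[k] |k. k < N} \<noteq> {}" using assms(2) by (auto simp: Suc_le_eq)
        fix w assume "w \<in> {[k] |k. k < N}"
        then obtain k where "w = [k]" "k < N" by blast
        then show "w \<in> words N \<and> w \<noteq> []"
          "\<exists>a t. a \<noteq> 0 \<and> (\<forall>x\<in>{0..1}. g (word_map \<Phi> w x) = a * g x + t)"
          using g(3)[of "\<Phi> ! k"] by (auto simp: set_\<Phi>)
      qed (rule that)
      have "log_cocycle (Fs k) q" if "k < N" for k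
        using q(2)[of "[k]"] that by simp
      then have HC_q: "HC i z = q z" if "i \<in> infwords N" "z \<in> unit_seg" for i z
        using HC_eq_if_log_cocycle[OF _ q(1)] that by blast
      have "\<forall>x\<in>{0..1}. H \<Phi> i x = H \<Phi> j x" if "i \<in> infwords N" "j \<in> infwords N" for i j
        unfolding HC_eq_iff[OF that] using HC_q that by simp
      then show "\<forall>i\<in>infwords N. \<forall>j\<in>infwords N. \<forall>x\<in>{0..1}. H \<Phi> i x = H \<Phi> j x"
        by blast
    next
      assume eq: "\<forall>i\<in>infwords N. \<forall>j\<in>infwords N. \<forall>x\<in>{0..1}. H \<Phi> i x = H \<Phi> j x"
      \<comment> \<open>The series of the constant word kkk... solves the equation of the map
        \<open>k\<close>. As all series agree, the one for 000... solves every equation, and the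
        coordinate \<open>g\<close> fixed above linearises all maps.\<close>
      have "log_cocycle (Fs k) (HC (periodic [0]))" if "k < N" for k
      proof -
        have k: "periodic [k] \<in> infwords N"
          using that by (auto intro!: periodic_infwords)
        have "log_cocycle (Fs k) (HC (periodic [k]))"
          using log_cocycle_periodic[of "[k]"] that by simp
        moreover have "Fs k ` unit_seg \<subseteq> unit_seg"
          using FW_unit_seg[OF letter[OF that]] by auto
        ultimately show ?thesis
          by (rule log_cocycle_cong) (use eq k zero HC_eq_iff[OF k zero] in blast)
      qed
      then show "\<exists>g. real_analytic_on g {0..1} \<and> inj_on g {0..1} \<and>
        (\<forall>f\<in>set \<Phi>. \<exists>a t. a \<in> {-1<..<1} - {0} \<and> (\<forall>x\<in>{0..1}. g (f x) = a * g x + t))"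
        using g sim unfolding set_\<Phi> by blast
    qed
  qed

  \<comment> \<open>Self-similarity of a pair of compositions\<close>
  have pair: "conjugated_to_self_similar [word_map \<Phi> (rev u), word_map \<Phi> (rev w)] \<longleftrightarrow>
      (\<forall>x\<in>{0..1}. H \<Phi> (periodic u) x = H \<Phi> (periodic w) x)"
    if uw: "u \<in> words N" "w \<in> words N" "u \<noteq> []" "w \<noteq> []" for u w
  proof -
    have rev: "rev u \<in> words N" "rev w \<in> words N" "rev u \<noteq> []" "rev w \<noteq> []"
      using uw by (auto simp: words_def)
    have into: "\<forall>f\<in>set [word_map \<Phi> (rev u), word_map \<Phi> (rev w)]. f ` {0..1} \<subseteq> {0..1}"
      using word_map_seg[OF rev(1)] word_map_seg[OF rev(2)] by auto
    have per: "periodic u \<in> infwords N" "periodic w \<in> infwords N"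
      using uw periodic_infwords by auto
    note cocycle = log_cocycle_periodic[OF uw(1,3)] log_cocycle_periodic[OF uw(2,4)]
    show ?thesis
      unfolding conjugated_to_self_similar_iff_similarity[OF into] HC_eq_iff[OF per]
    proof
      assume "\<exists>g. real_analytic_on g {0..1} \<and> inj_on g {0..1} \<and>
        (\<forall>f\<in>set [word_map \<Phi> (rev u), word_map \<Phi> (rev w)].
            \<exists>a t. a \<in> {-1<..<1} - {0} \<and> (\<forall>x\<in>{0..1}. g (f x) = a * g x + t))"
      then obtain g where g: "real_analytic_on g {0..1}" "inj_on g {0..1}"
        "\<And>f. f \<in> {word_map \<Phi> (rev u), word_map \<Phi> (rev w)} \<Longrightarrow>
            \<exists>a t. a \<in> {-1<..<1} - {0} \<and> (\<forall>x\<in>{0..1}. g (f x) = a * g x + t)"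
        by auto
      obtain q where q: "bounded (q ` unit_seg)" "\<And>v. v \<in> {rev u, rev w} \<Longrightarrow> log_cocycle (FW v) q"
      proof (rule similarity_imp_log_cocycle[OF g(1,2), of "{rev u, rev w}"])
        fix v assume "v \<in> {rev u, rev w}"
        then show "v \<in> words N \<and> v \<noteq> []"
          "\<exists>a t. a \<noteq> 0 \<and> (\<forall>x\<in>{0..1}. g (word_map \<Phi> v x) = a * g x + t)"
          using g(3)[of "word_map \<Phi> v"] rev by auto
      qed (simp, rule that)
      \<comment> \<open>The common solution \<open>q\<close> and each periodic series are bounded
        solutions of the same equation, so uniqueness identifies both series with
        \<open>q\<close>.\<close>
      have "HC (periodic u) z = q z" "HC (periodic w) z = q z" if "z \<in> unit_seg" for z
        using log_cocycle_unique[OF seg_contraction_FW[OF rev(1,3)] cocycle(1) q(2) bounded_HC[OF per(1)] q(1) that]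
          log_cocycle_unique[OF seg_contraction_FW[OF rev(2,4)] cocycle(2) q(2) bounded_HC[OF per(2)] q(1) that]
        by auto
      then show "\<forall>z\<in>unit_seg. HC (periodic u) z = HC (periodic w) z"
        by simp
    next
      assume eq: "\<forall>z\<in>unit_seg. HC (periodic u) z = HC (periodic w) z"
      obtain G where G: "linearizer \<epsilon> (HC (periodic u)) G"
        using linearizer_exists[OF holomorphic_HC[OF per(1)] eps HC_real[OF per(1)]] by blast
      have "log_cocycle (FW (rev w)) (HC (periodic u))"
        by (rule log_cocycle_cong[OF cocycle(2)]) (use eq FW_unit_seg[OF rev(2)] in auto)
      then show "\<exists>g. real_analytic_on g {0..1} \<and> inj_on g {0..1} \<and>
        (\<forall>f\<in>set [word_map \<Phi> (rev u), word_map \<Phi> (rev w)].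
            \<exists>a t. a \<in> {-1<..<1} - {0} \<and> (\<forall>x\<in>{0..1}. g (f x) = a * g x + t))"
        using linearizer_real_analytic[OF G] log_cocycle_imp_similarity[OF G rev(1,3) cocycle(1)]
          log_cocycle_imp_similarity[OF G rev(2,4)]
        by (intro exI[of _ "\<lambda>x. Re (G (of_real x))"]) simp
    qed
  qed

  \<comment> \<open>Reversal is a length-preserving bijection of words; it reconciles the order of
    composition in \<open>word_map\<close> with that in \<open>H\<close>.\<close>
  have "sub_conjugated_to_self_similar \<Phi> \<longleftrightarrow>
      (\<exists>i\<in>words N. \<exists>j\<in>words N. i \<noteq> j \<and> length i = length j \<and>
         conjugated_to_self_similar [word_map \<Phi> (rev i), word_map \<Phi> (rev j)])"
  proof -
    have rev: "rev w \<in> words N \<longleftrightarrow> w \<in> words N" for w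
      by (simp add: words_def)
    show ?thesis
      unfolding sub_conjugated_to_self_similar_def len
    proof (intro iffI; elim bexE conjE)
      fix i j
      assume "i \<in> words N" "j \<in> words N" "i \<noteq> j" "length i = length j"
        and "conjugated_to_self_similar [word_map \<Phi> i, word_map \<Phi> j]"
      then show "\<exists>i\<in>words N. \<exists>j\<in>words N. i \<noteq> j \<and> length i = length j \<and>
          conjugated_to_self_similar [word_map \<Phi> (rev i), word_map \<Phi> (rev j)]"
        by (intro bexI[of _ "rev i"] bexI[of _ "rev j"]) (auto simp: rev)
    next
      fix i j
      assume "i \<in> words N" "j \<in> words N" "i \<noteq> j" "length i = length j"
        and "conjugated_to_self_similar [word_map \<Phi> (rev i), word_map \<Phi> (rev j)]"
      then show "\<exists>i\<in>words N. \<exists>j\<in>words N. i \<noteq> j \<and> length i = length j \<and>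
          conjugated_to_self_similar [word_map \<Phi> i, word_map \<Phi> j]"
        by (intro bexI[of _ "rev i"] bexI[of _ "rev j"]) (auto simp: rev)
    qed
  qed
  also have "\<dots> \<longleftrightarrow> (\<exists>i\<in>words N. \<exists>j\<in>words N. i \<noteq> j \<and> length i = length j \<and>
      (\<forall>x\<in>{0..1}. H \<Phi> (periodic i) x = H \<Phi> (periodic j) x))"
  proof (intro bex_cong refl conj_cong)
    fix i j assume "i \<in> words N" "j \<in> words N" "i \<noteq> j" "length i = length j"
    \<comment> \<open>Distinct words of equal length are non-empty, as \<open>pair\<close>
      requires.\<close>
    then show "conjugated_to_self_similar [word_map \<Phi> (rev i), word_map \<Phi> (rev j)] \<longleftrightarrow>
        (\<forall>x\<in>{0..1}. H \<Phi> (periodic i) x = H \<Phi> (periodic j) x)"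
      by (intro pair) auto
  qed
  finally show ?thesis
    using part1 part2 by blast
qed

end
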